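(* Let $\mathbb{G}$ be a homogeneous group of homogeneous dimension $Q\ge5$, let $|\cdot|$ be a homogeneous quasi-norm on $\mathbb{G}$, and let $\mathcal{R}$ be the associated radial derivative operator. Then for every complex-valued function $f\in C_0^\infty(\mathbb{G}\setminus\{0\})$, $$\left\|\mathcal{R}^2f+\frac{Q-1}{|x|}\mathcal{R}f+\frac{Q(Q-4)}{4|x|^2}f\right\|_{L^2(\mathbb{G})}^2+\frac{Q(Q-4)}{2}\left\|\frac{1}{|x|}\mathcal{R}f+\frac{Q-4}{2|x|^2}f\right\|_{L^2(\mathbb{G})}^2$$ $$=\left\|\mathcal{R}^2f+\frac{Q-1}{|x|}\mathcal{R}f\right\|_{L^2(\mathbb{G})}^2-\left(\frac{Q(Q-4)}{4}\right)^2\left\|\frac{f}{|x|^2}\right\|_{L^2(\mathbb{G})}^2 .$$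
   Context: A homogeneous group $\mathbb{G}$ is a connected, simply connected Lie group whose Lie algebra $\mathfrak{g}$ is equipped with a family of dilations $D_\lambda=\mathrm{Exp}(A\ln\lambda)=\sum_{k\ge0}\frac{1}{k!}(\ln(\lambda)A)^k$, $\lambda>0$, where $A$ is a diagonalisable linear operator on $\mathfrak{g}$ with positive eigenvalues and each $D_\lambda$ is a Lie algebra morphism. Such a group is nilpotent and the exponential map $\exp_{\mathbb{G}}:\mathfrak{g}\to\mathbb{G}$ is a global diffeomorphism; it transports the dilations to $\mathbb{G}$, where they are written $D_\lambda x$ or $\lambda x$, i.e. $D_\lambda(\exp_{\mathbb{G}}X)=\exp_{\mathbb{G}}(D_\lambda X)$. The homogeneous dimension is $Q=\mathrm{Tr}\,A$. The identity element of $\mathbb{G}$ is denoted $0$, $dx$ denotes Haar measure on $\mathbb{G}$, and $L^2(\mathbb{G})$ is taken with respect to $dx$. A homogeneous quasi-norm is a continuous function $|\cdot|:\mathbb{G}\to[0,\infty)$ with $|x^{-1}|=|x|$ for all $x\in\mathbb{G}$, $|\lambda x|=\lambda|x|$ for all $x\in\mathbb{G}$, $\lambda>0$, and $|x|=0$ if and only if $x=0$. The operator $\mathcal{R}=\frac{d}{d|x|}$ is the radial derivative: for $x\neq 0$, writing $x=D_{\rho}y$ with $\rho=|x|$ and $|y|=1$, $\mathcal{R}f(x)=\frac{d}{dr}f(D_r y)\big|_{r=\rho}$. $\mathcal{R}^2f=\mathcal{R}(\mathcal{R}f)$. $C_0^\infty(\mathbb{G}\setminus\{0\})$ is the space of smooth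 functions with compact support in $\mathbb{G}\setminus\{0\}$. *)

theory Defs
  imports "HOL-Analysis.Analysis"
begin

section \<open>Smooth manifolds and smooth maps\<close>

text \<open>
  Iterated Frechet derivatives, to be used on open sets only: \<open>f\<close> is of class \<open>C^(k+1)\<close> on \<open>S\<close> if
  it is differentiable there and all its directional derivatives are of class \<open>C^k\<close>.
\<close>

primrec Ck_on :: "nat \<Rightarrow> 'a::euclidean_space set \<Rightarrow> ('a \<Rightarrow> 'b::real_normed_vector) \<Rightarrow> bool" where
  "Ck_on 0 = (\<lambda>S f. continuous_on S f)"
| "Ck_on (Suc k) = (\<lambda>S f. (\<forall>x\<in>S. f differentiable (at x)) \<and>
     (\<forall>v. Ck_on k S (\<lambda>x. frechet_derivative f (at x) v)))"

definition smooth_on :: "'a::euclidean_space set \<Rightarrow> ('a \<Rightarrow> 'b::real_normed_vector) \<Rightarrow> bool" where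
  "smooth_on S f \<longleftrightarrow> (\<forall>k. Ck_on k S f)"

text \<open>A chart is a domain together with a coordinate map, whose values off the domain are irrelevant.\<close>

type_synonym ('m, 'e) chart = "'m set \<times> ('m \<Rightarrow> 'e)"

definition smooth_atlas ::
    "('m::{t2_space, second_countable_topology}, 'e::euclidean_space) chart set \<Rightarrow> bool" where
  "smooth_atlas \<A> \<longleftrightarrow>
     (\<Union>(U, \<phi>)\<in>\<A>. U) = UNIV \<and>
     (\<forall>(U, \<phi>)\<in>\<A>. open U \<and> open (\<phi> ` U) \<and> homeomorphism U (\<phi> ` U) \<phi> (inv_into U \<phi>)) \<and>
     (\<forall>(U, \<phi>)\<in>\<A>. \<forall>(V, \<psi>)\<in>\<A>. smooth_on (\<phi> ` (U \<inter> V)) (\<psi> \<circ> inv_into U \<phi>))"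

definition smooth_map ::
    "('m::topological_space, 'e::euclidean_space) chart set
     \<Rightarrow> ('n::topological_space, 'd::euclidean_space) chart set \<Rightarrow> ('m \<Rightarrow> 'n) \<Rightarrow> bool" where
  "smooth_map \<A> \<B> F \<longleftrightarrow> continuous_on UNIV F \<and>
     (\<forall>(U, \<phi>)\<in>\<A>. \<forall>(V, \<psi>)\<in>\<B>. smooth_on (\<phi> ` (U \<inter> F -` V)) (\<psi> \<circ> F \<circ> inv_into U \<phi>))"

definition euclidean_atlas :: "('e::euclidean_space, 'e) chart set" where
  "euclidean_atlas = {(UNIV, id)}"

definition product_atlas ::
    "('m, 'e) chart set \<Rightarrow> ('n, 'd) chart set \<Rightarrow> ('m \<times> 'n, 'e \<times> 'd) chart set" where
  "product_atlas \<A> \<B> = {(U \<times> V, map_prod \<phi> \<psi>) | U \<phi> V \<psi>. (U, \<phi>) \<in> \<A> \<and> (V, \<psi>) \<in> \<B>}"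

abbreviation smooth_fun ::
    "('m::topological_space, 'e::euclidean_space) chart set \<Rightarrow> ('m \<Rightarrow> 'b::euclidean_space) \<Rightarrow> bool" where
  "smooth_fun \<A> f \<equiv> smooth_map \<A> euclidean_atlas f"

definition diffeomorphism ::
    "('m::topological_space, 'e::euclidean_space) chart set
     \<Rightarrow> ('n::topological_space, 'd::euclidean_space) chart set \<Rightarrow> ('m \<Rightarrow> 'n) \<Rightarrow> bool" where
  "diffeomorphism \<A> \<B> F \<longleftrightarrow> bij F \<and> smooth_map \<A> \<B> F \<and> smooth_map \<B> \<A> (inv F)"


section \<open>Lie groups, Lie algebras and the exponential map\<close>

text \<open>
  The group law is that of the class \<open>group_add\<close>, which does not assume commutativity: the product
  of \<open>x\<close> and \<open>y\<close> is \<open>x + y\<close>, the inverse of \<open>x\<close> is \<open>- x\<close>, and the identity element is \<open>0\<close>.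
\<close>

definition lie_group ::
    "('g::{group_add, t2_space, second_countable_topology}, 'e::euclidean_space) chart set \<Rightarrow> bool" where
  "lie_group \<A> \<longleftrightarrow> smooth_atlas \<A> \<and>
     smooth_map (product_atlas \<A> \<A>) \<A> (\<lambda>(x, y). x + y) \<and>
     smooth_map \<A> \<A> uminus"

text \<open>
  Left-invariant vector fields as derivations of the algebra of smooth real functions that commute
  with left translations. The first clause normalises the value on non-smooth functions, so
  that equality in HOL is equality of vector fields.
\<close>

definition left_invariant_fields ::
    "('g::{group_add, t2_space, second_countable_topology}, 'e::euclidean_space) chart set
     \<Rightarrow> (('g \<Rightarrow> real) \<Rightarrow> 'g \<Rightarrow> real) set" where
  "left_invariant_fields \<A> = {X.
     (\<forall>f. \<not> smooth_fun \<A> f \<longrightarrow> X f = (\<lambda>_. 0)) \<and>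
     (\<forall>f. smooth_fun \<A> f \<longrightarrow> smooth_fun \<A> (X f)) \<and>
     (\<forall>f g. smooth_fun \<A> f \<longrightarrow> smooth_fun \<A> g \<longrightarrow>
        X (\<lambda>x. f x + g x) = (\<lambda>x. X f x + X g x)) \<and>
     (\<forall>c f. smooth_fun \<A> f \<longrightarrow> X (\<lambda>x. c * f x) = (\<lambda>x. c * X f x)) \<and>
     (\<forall>f g. smooth_fun \<A> f \<longrightarrow> smooth_fun \<A> g \<longrightarrow>
        X (\<lambda>x. f x * g x) = (\<lambda>x. f x * X g x + g x * X f x)) \<and>
     (\<forall>a f. smooth_fun \<A> f \<longrightarrow> X (\<lambda>x. f (a + x)) = (\<lambda>x. X f (a + x)))}"

text \<open>
  The Lie algebra of an \<open>n\<close>-dimensional Lie group is named by \<open>real ^ 'n\<close>, through a linear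
  isomorphism \<open>\<Theta>\<close> onto the space of left-invariant vector fields (that is, a choice of a basis).
\<close>

definition lie_algebra_iso ::
    "('g::{group_add, t2_space, second_countable_topology}, real ^ 'n::finite) chart set
     \<Rightarrow> (real ^ 'n \<Rightarrow> ('g \<Rightarrow> real) \<Rightarrow> 'g \<Rightarrow> real) \<Rightarrow> bool" where
  "lie_algebra_iso \<A> \<Theta> \<longleftrightarrow>
     bij_betw \<Theta> UNIV (left_invariant_fields \<A>) \<and>
     (\<forall>X Y f x. \<Theta> (X + Y) f x = \<Theta> X f x + \<Theta> Y f x) \<and>
     (\<forall>c X f x. \<Theta> (c *\<^sub>R X) f x = c * \<Theta> X f x)"

text \<open>The commutator of vector fields, pulled back along \<open>\<Theta>\<close>.\<close>

definition lie_bracket ::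
    "(real ^ 'n::finite \<Rightarrow> ('g \<Rightarrow> real) \<Rightarrow> 'g \<Rightarrow> real) \<Rightarrow> real ^ 'n \<Rightarrow> real ^ 'n \<Rightarrow> real ^ 'n" where
  "lie_bracket \<Theta> X Y = inv \<Theta> (\<lambda>f x. \<Theta> X (\<Theta> Y f) x - \<Theta> Y (\<Theta> X f) x)"

definition one_parameter_subgroup ::
    "('g::{group_add, t2_space, second_countable_topology}, real ^ 'n::finite) chart set
     \<Rightarrow> (real ^ 'n \<Rightarrow> ('g \<Rightarrow> real) \<Rightarrow> 'g \<Rightarrow> real) \<Rightarrow> real ^ 'n \<Rightarrow> (real \<Rightarrow> 'g) \<Rightarrow> bool" where
  "one_parameter_subgroup \<A> \<Theta> X \<gamma> \<longleftrightarrow>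
     smooth_map euclidean_atlas \<A> \<gamma> \<and>
     (\<forall>s t. \<gamma> (s + t) = \<gamma> s + \<gamma> t) \<and>
     (\<forall>f t. smooth_fun \<A> f \<longrightarrow>
        ((\<lambda>s. f (\<gamma> s)) has_real_derivative \<Theta> X f (\<gamma> t)) (at t))"

text \<open>
  Every \<open>X\<close> generates exactly one one-parameter subgroup, so \<open>E\<close> is uniquely determined: \<open>E X\<close> is
  its value at time \<open>1\<close>.
\<close>

definition is_lie_exp ::
    "('g::{group_add, t2_space, second_countable_topology}, real ^ 'n::finite) chart set
     \<Rightarrow> (real ^ 'n \<Rightarrow> ('g \<Rightarrow> real) \<Rightarrow> 'g \<Rightarrow> real) \<Rightarrow> (real ^ 'n \<Rightarrow> 'g) \<Rightarrow> bool" where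
  "is_lie_exp \<A> \<Theta> E \<longleftrightarrow> (\<forall>X. one_parameter_subgroup \<A> \<Theta> X (\<lambda>t. E (t *\<^sub>R X)))"


section \<open>Homogeneous groups\<close>

definition diagonalisable_pos :: "(real ^ 'n::finite \<Rightarrow> real ^ 'n) \<Rightarrow> bool" where
  "diagonalisable_pos A \<longleftrightarrow> linear A \<and>
     (\<exists>B. independent B \<and> span B = UNIV \<and> (\<forall>b\<in>B. \<exists>\<nu>>0. A b = \<nu> *\<^sub>R b))"

text \<open>The exponential of the linear operator \<open>ln r A\<close>; meaningful for \<open>r > 0\<close>.\<close>

definition lie_dilation ::
    "(real ^ 'n::finite \<Rightarrow> real ^ 'n) \<Rightarrow> real \<Rightarrow> real ^ 'n \<Rightarrow> real ^ 'n" where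
  "lie_dilation A r X = (\<Sum>k. (1 / fact k) *\<^sub>R (((\<lambda>Y. ln r *\<^sub>R A Y) ^^ k) X))"

text \<open>
  That the exponential map is a global diffeomorphism is a theorem about connected, simply connected
  Lie groups whose Lie algebra carries such dilations. It is listed here because the dilations of the
  group are defined by means of it; it does not restrict the class of groups.
\<close>

definition homogeneous_group ::
    "('g::{group_add, t2_space, second_countable_topology}, real ^ 'n::finite) chart set
     \<Rightarrow> (real ^ 'n \<Rightarrow> ('g \<Rightarrow> real) \<Rightarrow> 'g \<Rightarrow> real) \<Rightarrow> (real ^ 'n \<Rightarrow> 'g)
     \<Rightarrow> (real ^ 'n \<Rightarrow> real ^ 'n) \<Rightarrow> bool" where
  "homogeneous_group \<A> \<Theta> E A \<longleftrightarrow>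
     lie_group \<A> \<and> connected (UNIV :: 'g set) \<and> simply_connected (UNIV :: 'g set) \<and>
     lie_algebra_iso \<A> \<Theta> \<and>
     is_lie_exp \<A> \<Theta> E \<and> diffeomorphism euclidean_atlas \<A> E \<and>
     diagonalisable_pos A \<and>
     (\<forall>r>0. linear (lie_dilation A r) \<and>
        (\<forall>X Y. lie_dilation A r (lie_bracket \<Theta> X Y)
             = lie_bracket \<Theta> (lie_dilation A r X) (lie_dilation A r Y)))"

definition homogeneous_dimension :: "(real ^ 'n::finite \<Rightarrow> real ^ 'n) \<Rightarrow> real" where
  "homogeneous_dimension A = trace (matrix A)"

definition group_dilation ::
    "(real ^ 'n::finite \<Rightarrow> 'g) \<Rightarrow> (real ^ 'n \<Rightarrow> real ^ 'n) \<Rightarrow> real \<Rightarrow> 'g \<Rightarrow> 'g" where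
  "group_dilation E A r x = E (lie_dilation A r (inv E x))"

text \<open>Here and below \<open>\<delta>\<close> stands for the dilations of the group.\<close>

definition homogeneous_quasi_norm ::
    "(real \<Rightarrow> 'g \<Rightarrow> 'g) \<Rightarrow> ('g::{group_add, topological_space} \<Rightarrow> real) \<Rightarrow> bool" where
  "homogeneous_quasi_norm \<delta> N \<longleftrightarrow> continuous_on UNIV N \<and> (\<forall>x. N x \<ge> 0) \<and>
     (\<forall>x. N (- x) = N x) \<and>
     (\<forall>r>0. \<forall>x. N (\<delta> r x) = r * N x) \<and>
     (\<forall>x. N x = 0 \<longleftrightarrow> x = 0)"

text \<open>
  For \<open>x \<noteq> 0\<close> the point \<open>y = \<delta> (1 / N x) x\<close> is the one with \<open>N y = 1\<close> and \<open>x = \<delta> (N x) y\<close>.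
  The value at \<open>0\<close> has no meaning.
\<close>

definition radial_derivative ::
    "(real \<Rightarrow> 'g \<Rightarrow> 'g) \<Rightarrow> ('g \<Rightarrow> real) \<Rightarrow> ('g \<Rightarrow> complex) \<Rightarrow> 'g \<Rightarrow> complex" where
  "radial_derivative \<delta> N f x = vector_derivative (\<lambda>r. f (\<delta> r (\<delta> (1 / N x) x))) (at (N x))"

text \<open>Left Haar measures; homogeneous groups, being nilpotent, are unimodular.\<close>

definition haar_measure :: "'g::{group_add, topological_space} measure \<Rightarrow> bool" where
  "haar_measure \<mu> \<longleftrightarrow> sets \<mu> = sets borel \<and>
     (\<forall>a. \<forall>S\<in>sets borel. emeasure \<mu> ((\<lambda>x. a + x) ` S) = emeasure \<mu> S) \<and>
     (\<forall>K. compact K \<longrightarrow> emeasure \<mu> K < \<infinity>) \<and>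
     (\<forall>U. open U \<longrightarrow> U \<noteq> {} \<longrightarrow> emeasure \<mu> U > 0)"

text \<open>
  Intended for square-integrable functions only, since the Bochner integral is \<open>0\<close> when the integrand
  is not integrable.
\<close>

definition L2_norm :: "'g measure \<Rightarrow> ('g \<Rightarrow> complex) \<Rightarrow> real" where
  "L2_norm \<mu> f = sqrt (LINT x|\<mu>. (cmod (f x))\<^sup>2)"

definition test_functions_off_zero ::
    "('g::{group_add, t2_space, second_countable_topology}, 'e::euclidean_space) chart set
     \<Rightarrow> ('g \<Rightarrow> complex) set" where
  "test_functions_off_zero \<A> = {f. smooth_fun \<A> f \<and>
     compact (closure {x. f x \<noteq> 0}) \<and> closure {x. f x \<noteq> 0} \<subseteq> - {0}}"

end

theory Submission
  imports Defs
begin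

text \<open>
  In exponential coordinates the rays through the origin are one-parameter subgroups, so the
  left-trivialised differential \<open>K\<close> of the exponential map solves the linear equation
  \<open>K' = Y - [X, K]\<close> along the ray of \<open>X\<close>. As the dilations respect the bracket, uniqueness for this
  equation makes its determinant dilation invariant, hence constant (contract to the origin). So
  Lebesgue measure is left invariant in these coordinates; it is also invariant under inversion
  \<open>p \<mapsto> - p\<close>, and Fubini's theorem shows that every Haar measure is proportional to it. In particular
  dilation by \<open>r\<close> multiplies Haar measure by \<open>r powr Q\<close>.

  Writing \<open>u\<close> for \<open>f\<close> in coordinates, \<open>v\<close> and \<open>w\<close> for its first and second derivatives along the
  generator of the dilations, \<open>R f = v / N\<close> and \<open>R (R f) = (w - v) / N\<^sup>2\<close>. The difference of
  the two sides is a multiple of the integral of \<open>(H' + (Q - 4) H) / N ^ 4\<close>, where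
  \<open>H = Re (v cnj u) + (Q - 2) / 2 \<bar>u\<bar>\<^sup>2\<close> and \<open>H'\<close> is its derivative along the generator. That integral
  vanishes: differentiate the scaling law of the integral of \<open>H / N ^ 4\<close>.
\<close>

section \<open>Calculus of smooth maps\<close>

text \<open>The quasi-norm is merely continuous, so \<open>N\<close> can be differentiated only
  along dilation orbits, where homogeneity makes it linear in the parameter. Hence the scaling law
  in place of a divergence theorem: the derivative falls on \<open>H\<close> alone, while
  \<open>N\<close> and the measure contribute exact powers of \<open>r\<close>. The equation for
  \<open>K\<close> along a fixed ray has constant coefficients, built from the bracket only; this is
  how a condition on the Lie algebra reaches the frame of the group. The Fubini argument needs
  Lebesgue measure to be right invariant. Left invariance and \<open>p \<mapsto> - p\<close>, which
  is group inversion in these coordinates, give it. \<open>H\<close> is dictated by algebra. Put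
  \<open>a = Q (Q - 4) / 4\<close>. Since \<open>R (R f) + (Q - 1) / N * R f\<close> is
  \<open>(w + (Q - 2) v) / N^2\<close>, the cross term of the first norm is
  \<open>2 a (w . u + (Q - 2) v . u)\<close>. The second norm brings
  \<open>2 a (v . v + (Q - 4) v . u)\<close>, and the terms in \<open>|u|^2\<close> add up to
  \<open>a (Q - 4) (Q - 2) |u|^2\<close>. The coefficient \<open>(Q - 2) / 2\<close> in
  \<open>H\<close> makes \<open>(Q - 2) v . u\<close> a part of \<open>H'\<close>; what remains is
  \<open>2 a (Q - 4) H\<close>.\<close>

lemma Ck_on_cong:
  assumes "open S" "\<And>x. x \<in> S \<Longrightarrow> f x = g x"
  shows "Ck_on k S f = Ck_on k S g"
  using assms(2)
proof (induction k arbitrary: f g)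
  case 0
  then show ?case using continuous_on_cong[OF refl, of S f g] by simp
next
  case (Suc k)
  have ev: "(f has_derivative F) (at x) = (g has_derivative F) (at x)" if "x \<in> S" for x F
    using has_derivative_transform_within_open[OF _ \<open>open S\<close> that, of f F UNIV g]
      has_derivative_transform_within_open[OF _ \<open>open S\<close> that, of g F UNIV f] Suc.prems by auto
  have "f differentiable at x \<longleftrightarrow> g differentiable at x" if "x \<in> S" for x
    using ev[OF that] by (simp add: differentiable_def)
  moreover have "frechet_derivative f (at x) v = frechet_derivative g (at x) v" if "x \<in> S" for x v
    using ev[OF that] by (simp add: frechet_derivative_def)
  ultimately show ?case
    using Suc.IH by (metis (no_types, lifting) Ck_on.simps(2))
qed

lemma Ck_on_Union:
  assumes "\<And>S. S \<in> \<S> \<Longrightarrow> open S" "\<And>S. S \<in> \<S> \<Longrightarrow> Ck_on k S f"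
  shows "Ck_on k (\<Union>\<S>) f"
  using assms(2)
proof (induction k arbitrary: f)
  case 0
  then show ?case using assms(1) by (auto intro!: continuous_on_open_Union)
qed auto

lemma Ck_on_SucD: "Ck_on (Suc k) S f \<Longrightarrow> Ck_on k S f"
proof (induction k arbitrary: f)
  case 0
  then show ?case
    by (auto intro!: continuous_at_imp_continuous_on differentiable_imp_continuous_within)
qed auto

lemma Ck_on_SucI:
  assumes "open S" "\<And>x. x \<in> S \<Longrightarrow> (f has_derivative f' x) (at x)" "\<And>v. Ck_on k S (\<lambda>x. f' x v)"
  shows "Ck_on (Suc k) S f"
proof -
  have "frechet_derivative f (at x) = f' x" if "x \<in> S" for x
    using frechet_derivative_at[OF assms(2)[OF that]] by simp
  then have "Ck_on k S (\<lambda>x. frechet_derivative f (at x) v)" for v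
    using Ck_on_cong[OF assms(1), of "\<lambda>x. frechet_derivative f (at x) v" "\<lambda>x. f' x v"] assms(3)
    by simp
  then show ?thesis using assms(2) by (auto simp: differentiable_def)
qed

lemma Ck_on_Suc_has_derivative:
  "Ck_on (Suc k) S f \<Longrightarrow> x \<in> S \<Longrightarrow> (f has_derivative frechet_derivative f (at x)) (at x)"
  by (simp add: frechet_derivative_works)

lemma Ck_on_const: "open S \<Longrightarrow> Ck_on k S (\<lambda>x. c)"
  by (induction k arbitrary: c) (auto intro!: Ck_on_SucI[where f' = "\<lambda>_ _. 0"] simp del: Ck_on.simps(2))

lemma Ck_on_bounded_linear:
  assumes "open S" "bounded_linear h" shows "Ck_on k S h"
proof (cases k)
  case 0 then show ?thesis using assms
    by (auto intro: bounded_linear.continuous_on continuous_on_id)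
next
  case (Suc j)
  then show ?thesis
    using Ck_on_SucI[OF assms(1), of h "\<lambda>_. h"] bounded_linear.has_derivative[OF assms(2), of "\<lambda>x. x" "\<lambda>x. x"]
    by (auto intro: Ck_on_const[OF assms(1)] simp del: Ck_on.simps(2))
qed

lemma Ck_on_linear_compose:
  assumes "open S" "bounded_linear h" "Ck_on k S f" shows "Ck_on k S (\<lambda>x. h (f x))"
  using assms(3)
proof (induction k arbitrary: f)
  case 0 then show ?case using assms(2) by (auto intro: bounded_linear.continuous_on)
next
  case (Suc k)
  show ?case
    by (rule Ck_on_SucI[OF assms(1) bounded_linear.has_derivative[OF assms(2) Ck_on_Suc_has_derivative[OF Suc.prems]]])
      (use Suc in auto)
qed

lemma Ck_on_add:
  assumes "open S" "Ck_on k S f" "Ck_on k S g" shows "Ck_on k S (\<lambda>x. f x + g x)"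
  using assms(2,3)
proof (induction k arbitrary: f g)
  case 0 then show ?case by (auto intro: continuous_on_add)
next
  case (Suc k)
  show ?case
    by (rule Ck_on_SucI[OF assms(1) has_derivative_add[OF Ck_on_Suc_has_derivative[OF Suc.prems(1)]
            Ck_on_Suc_has_derivative[OF Suc.prems(2)]]])
      (use Suc in auto)
qed

lemma Ck_on_sum:
  assumes "open S" "\<And>i. i \<in> I \<Longrightarrow> Ck_on k S (f i)" shows "Ck_on k S (\<lambda>x. \<Sum>i\<in>I. f i x)"
  using assms(2)
  by (induction I rule: infinite_finite_induct) (auto intro: Ck_on_const Ck_on_add assms(1))

lemma Ck_on_bilinear:
  assumes "open S" "bounded_bilinear h" "Ck_on k S f" "Ck_on k S g"
  shows "Ck_on k S (\<lambda>x. h (f x) (g x))"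
  using assms(3,4)
proof (induction k arbitrary: f g)
  case 0 then show ?case using bounded_bilinear.continuous_on[OF assms(2)] by auto
next
  case (Suc k)
  show ?case
    by (rule Ck_on_SucI[OF assms(1) bounded_bilinear.FDERIV[OF assms(2) Ck_on_Suc_has_derivative[OF Suc.prems(1)]
            Ck_on_Suc_has_derivative[OF Suc.prems(2)]]])
      (use Suc.prems Ck_on_SucD[OF Suc.prems(1)] Ck_on_SucD[OF Suc.prems(2)] in
        \<open>auto intro!: Ck_on_add[OF assms(1)] Suc.IH\<close>)
qed

text \<open>In the chain rule the derivative of \<open>g\<close> is taken in a direction that moves
  with \<open>x\<close>, whereas \<open>Ck_on\<close> controls fixed directions only. Expanding the
  moving direction in the basis gives scalar coefficients times derivatives of \<open>g\<close> in
  fixed directions, to which the induction hypothesis applies.\<close>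

lemma Ck_on_compose:
  fixes f :: "'a::euclidean_space \<Rightarrow> 'b::euclidean_space" and g :: "'b \<Rightarrow> 'c::real_normed_vector"
  assumes "open S" "open T" "f ` S \<subseteq> T" "Ck_on k S f" "Ck_on k T g"
  shows "Ck_on k S (\<lambda>x. g (f x))"
  using assms(4,5)
proof (induction k arbitrary: g)
  case 0 then show ?case
    using assms(3) continuous_on_compose2 by auto
next
  case (Suc k)
  let ?f' = "\<lambda>x. frechet_derivative f (at x)" and ?g' = "\<lambda>y. frechet_derivative g (at y)"
  have g': "(g has_derivative ?g' y) (at y)" if "y \<in> T" for y
    using Suc.prems(2) that by (rule Ck_on_Suc_has_derivative)
  have f': "(f has_derivative ?f' x) (at x)" if "x \<in> S" for x
    using Suc.prems(1) that by (rule Ck_on_Suc_has_derivative)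
  have "((\<lambda>x. g (f x)) has_derivative (\<lambda>v. \<Sum>b\<in>Basis. (?f' x v \<bullet> b) *\<^sub>R ?g' (f x) b)) (at x)"
    if "x \<in> S" for x
  proof -
    have gd: "(g has_derivative ?g' (f x)) (at (f x))" using g' assms(3) that by blast
    have "?g' (f x) (?f' x v) = (\<Sum>b\<in>Basis. (?f' x v \<bullet> b) *\<^sub>R ?g' (f x) b)" for v
    proof -
      interpret linear "?g' (f x)" using gd by (rule has_derivative_linear)
      have "?g' (f x) (?f' x v) = ?g' (f x) (\<Sum>b\<in>Basis. (?f' x v \<bullet> b) *\<^sub>R b)"
        by (simp add: euclidean_representation)
      then show ?thesis by (simp add: sum scale)
    qed
    then show ?thesis
      using has_derivative_compose[OF f'[OF that] gd] by presburger
  qed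
  moreover have "Ck_on k S (\<lambda>x. \<Sum>b\<in>Basis. (?f' x v \<bullet> b) *\<^sub>R ?g' (f x) b)" for v
    using Suc.prems
    by (intro Ck_on_sum[OF assms(1)] Ck_on_bilinear[OF assms(1) bounded_bilinear_scaleR] Suc.IH
        Ck_on_linear_compose[OF assms(1) bounded_linear_inner_left] Ck_on_SucD[OF Suc.prems(1)]) auto
  ultimately show ?case by (intro Ck_on_SucI[OF assms(1)])
qed

lemma Ck_on_componentwise:
  fixes f :: "'a::euclidean_space \<Rightarrow> 'b::euclidean_space"
  assumes "open S" "\<And>b. b \<in> Basis \<Longrightarrow> Ck_on k S (\<lambda>x. f x \<bullet> b)"
  shows "Ck_on k S f"
proof -
  have "Ck_on k S (\<lambda>x. \<Sum>b\<in>Basis. (f x \<bullet> b) *\<^sub>R b)"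
    using assms by (intro Ck_on_sum Ck_on_linear_compose[OF _ bounded_linear_scaleR_left])
  then show ?thesis by (simp add: euclidean_representation)
qed


section \<open>Volume under maps of constant Jacobian\<close>

text \<open>A well-ordered copy of a finite type: the library's change of variables theorems ask for one.\<close>

typedef 'a enum_index = "UNIV :: 'a set" ..

instantiation enum_index :: (finite) "{finite, wellorder}"
begin

definition less_eq_enum_index :: "'a enum_index \<Rightarrow> 'a enum_index \<Rightarrow> bool" where
  "x \<le> y \<longleftrightarrow> to_nat_on UNIV (Rep_enum_index x) \<le> to_nat_on UNIV (Rep_enum_index y)"

definition less_enum_index :: "'a enum_index \<Rightarrow> 'a enum_index \<Rightarrow> bool" where
  "x < y \<longleftrightarrow> to_nat_on UNIV (Rep_enum_index x) < to_nat_on UNIV (Rep_enum_index y)"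

instance
proof
  have inj: "inj (\<lambda>x::'a enum_index. to_nat_on UNIV (Rep_enum_index x))"
    by (intro injI)
      (simp add: Rep_enum_index_inject inj_on_eq_iff[OF inj_on_to_nat_on[OF countable_finite]])
  show "finite (UNIV :: 'a enum_index set)"
    unfolding type_definition.Abs_image[OF type_definition_enum_index, symmetric]
    by (rule finite_imageI) (rule finite)
  show "x \<le> y \<Longrightarrow> y \<le> x \<Longrightarrow> x = y" for x y :: "'a enum_index"
    by (rule injD[OF inj]) (simp add: less_eq_enum_index_def)
  show "(\<And>x. (\<And>y. y < x \<Longrightarrow> P y) \<Longrightarrow> P x) \<Longrightarrow> P a" for P and a :: "'a enum_index"
    by (rule measure_induct_rule[of "\<lambda>x. to_nat_on UNIV (Rep_enum_index x)"])
      (auto simp: less_enum_index_def)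
qed (auto simp: less_eq_enum_index_def less_enum_index_def)

end

text \<open>Conjugation by \<open>h\<close> matches the permutations of the two index types and
  preserves signs, so the two Leibniz sums agree term by term.\<close>

lemma det_reindex:
  fixes A :: "real ^ 'n ^ 'n" and h :: "'m::finite \<Rightarrow> 'n::finite"
  assumes "bij h"
  shows "det (\<chi> i j. A $ h i $ h j) = det A"
proof -
  have per: "bij_betw (map_permutation UNIV h) {p. p permutes (UNIV::'m set)} {p. p permutes (UNIV::'n set)}"
  proof (rule bij_betw_byWitness[where f' = "map_permutation UNIV (inv h)"])
    have "inv h \<circ> h = id" "h \<circ> inv h = id"
      using assms by (simp_all add: bij_is_inj surj_iff[symmetric] bij_is_surj)
    then show "\<forall>p\<in>{p. p permutes UNIV}. map_permutation UNIV (inv h) (map_permutation UNIV h p) = p"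
      and "\<forall>p\<in>{p. p permutes UNIV}. map_permutation UNIV h (map_permutation UNIV (inv h) p) = p"
      using map_permutation_compose[OF assms bij_is_inj[OF bij_imp_bij_inv[OF assms]]]
        map_permutation_compose[OF bij_imp_bij_inv[OF assms] bij_is_inj[OF assms]]
      by simp_all
    show "map_permutation UNIV h ` {p. p permutes UNIV} \<subseteq> {p. p permutes UNIV}"
      using map_permutation_permutes[OF assms] by auto
    show "map_permutation UNIV (inv h) ` {p. p permutes UNIV} \<subseteq> {p. p permutes UNIV}"
      using map_permutation_permutes[OF bij_imp_bij_inv[OF assms]] by auto
  qed
  have "(\<Prod>i\<in>UNIV. A $ i $ map_permutation UNIV h p i) = (\<Prod>i\<in>UNIV. A $ h i $ h (p i))" if "p permutes UNIV" for p
  proof -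
    have "(\<Prod>i\<in>UNIV. A $ i $ map_permutation UNIV h p i)
        = (\<Prod>i\<in>UNIV. A $ h i $ map_permutation UNIV h p (h i))"
      using prod.reindex_bij_betw[OF assms, of "\<lambda>i. A $ i $ map_permutation UNIV h p i"] by simp
    also have "\<dots> = (\<Prod>i\<in>UNIV. A $ h i $ h (p i))"
      using assms by (intro prod.cong) (auto simp: map_permutation_def restrict_id_def bij_is_inj bij_is_surj)
    finally show ?thesis .
  qed
  moreover have "sign (map_permutation UNIV h p) = sign p" if "p permutes UNIV" for p
    using that assms by (intro sign_map_permutation) (auto simp: bij_is_inj)
  ultimately show ?thesis
    unfolding det_def using sum.reindex_bij_betw[OF per, symmetric,
      of "\<lambda>p. of_int (sign p) * (\<Prod>i\<in>UNIV. A $ i $ p i)"]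
    by (auto intro!: sum.cong)
qed

lemma vimage_eq_image_inverse:
  assumes "\<And>x. s (r x) = x" "\<And>y. r (s y) = y"
  shows "s -` S = r ` S"
proof (intro set_eqI iffI)
  fix y assume "y \<in> s -` S"
  then have "y = r (s y)" "s y \<in> S" using assms(2) by auto
  then show "y \<in> r ` S" by (rule image_eqI)
qed (use assms(1) in auto)

lemma prod_Basis_cart: "(\<Prod>b\<in>Basis. (x :: real ^ 'n::finite) \<bullet> b) = (\<Prod>i\<in>UNIV. x $ i)"
proof -
  have "bij_betw (\<lambda>i. axis i (1::real)) UNIV (Basis :: (real ^ 'n) set)"
    by (auto simp: bij_betw_def inj_on_def axis_eq_axis Basis_vec_def)
  from prod.reindex_bij_betw[OF this, of "\<lambda>b. x \<bullet> b"] show ?thesis by (simp add: inner_axis)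
qed

text \<open>Lebesgue measure is determined by the volumes of boxes, and relabelling coordinates only
  reorders the side lengths in the product.\<close>

lemma emeasure_lborel_reindex:
  fixes h :: "'m::finite \<Rightarrow> 'n::finite" and S :: "(real ^ 'n) set"
  assumes "bij h" "S \<in> sets borel"
  shows "emeasure lborel ((\<lambda>x. (\<chi> i. x $ h i)) ` S :: (real ^ 'm) set) = emeasure lborel S"
proof -
  let ?r = "\<lambda>x::real^'n. (\<chi> i. x $ h i) :: real ^ 'm" and ?s = "\<lambda>x::real^'m. (\<chi> i. x $ inv h i) :: real^'n"
  have sr: "?s (?r x) = x" "?r (?s y) = y" for x y
    using assms(1) by (auto simp: vec_eq_iff bij_is_surj surj_f_inv_f bij_is_inj)
  have meas: "?s \<in> borel \<rightarrow>\<^sub>M borel"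
    by (intro borel_measurable_continuous_onI continuous_intros)
  have "lborel = distr lborel borel ?s"
  proof (rule lborel_eqI)
    fix l u :: "real ^ 'n" assume lu: "\<And>b. b \<in> Basis \<Longrightarrow> l \<bullet> b \<le> u \<bullet> b"
    have le: "l $ i \<le> u $ i" for i
      using lu[of "axis i 1"] by (simp add: inner_axis axis_in_Basis_iff)
    have "?s -` box l u = box (?r l) (?r u)"
    proof -
      have "(\<forall>j. l $ j < x $ inv h j \<and> x $ inv h j < u $ j) \<longleftrightarrow>
          (\<forall>i. l $ h i < x $ i \<and> x $ i < u $ h i)" for x :: "real ^ 'm"
        using bij_inv_eq_iff[OF assms(1)] by metis
      then show ?thesis by (simp add: set_eq_iff mem_box_cart)
    qed
    then have "emeasure (distr lborel borel ?s) (box l u) = emeasure lborel (box (?r l) (?r u))"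
      using meas by (simp add: emeasure_distr)
    also have "\<dots> = (\<Prod>b\<in>Basis. (?r u - ?r l) \<bullet> b)"
      using le by (subst emeasure_lborel_box) (auto simp: Basis_vec_def inner_axis)
    also have "(\<Prod>b\<in>Basis. (?r u - ?r l) \<bullet> b) = (\<Prod>i\<in>UNIV. (?r u - ?r l) $ i)"
      by (rule prod_Basis_cart)
    also have "\<dots> = (\<Prod>i\<in>UNIV. (u - l) $ i)"
      using prod.reindex_bij_betw[OF assms(1), of "\<lambda>i. (u - l) $ i"] by simp
    also have "\<dots> = (\<Prod>b\<in>Basis. (u - l) \<bullet> b)"
      by (rule prod_Basis_cart[symmetric])
    finally show "emeasure (distr lborel borel ?s) (box l u) = (\<Prod>b\<in>Basis. (u - l) \<bullet> b)" .
  qed simp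
  then have "emeasure lborel S = emeasure (distr lborel borel ?s) S" by simp
  also have "\<dots> = emeasure lborel (?s -` S)"
    using meas assms(2) by (simp add: emeasure_distr)
  also have "?s -` S = ?r ` S"
    using sr by (intro vimage_eq_image_inverse)
  finally show ?thesis by simp
qed

lemma emeasure_lborel_image_wellorder:
  fixes f :: "real ^ 'n::{finite,wellorder} \<Rightarrow> real ^ 'n::_" and c :: real
  assumes "\<And>x. (f has_derivative f' x) (at x)" "inj f" "\<And>x. \<bar>det (matrix (f' x))\<bar> = c" "c > 0"
    "S \<in> sets borel" "f ` S \<in> sets borel"
  shows "emeasure lborel (f ` S) = c * emeasure lborel S"
proof -
  have f': "(f has_derivative f' x) (at x within S)" for x
    using assms(1) has_derivative_at_withinI by blast
  have S: "S \<in> sets lebesgue" and fS: "f ` S \<in> sets lebesgue"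
    using assms(5,6) by auto
  have injS: "inj_on f S" using assms(2) inj_on_subset by blast
  note * = has_measure_differentiable_image[OF S f' injS, unfolded assms(3)]
  show ?thesis
  proof (cases "S \<in> lmeasurable")
    case True
    then have "((\<lambda>x. c) has_integral c * measure lebesgue S) S"
      using has_integral_mult_right[of "\<lambda>x. 1" "measure lebesgue S" S c]
      by (simp add: has_integral_measure_lborel lmeasure_integral lmeasurable_iff_integrable_on
          integrable_integral)
    with * have "f ` S \<in> lmeasurable" "measure lebesgue (f ` S) = c * measure lebesgue S" by auto
    then have "emeasure lebesgue (f ` S) = c * emeasure lebesgue S"
      using True assms(4) by (simp add: emeasure_eq_measure2 ennreal_mult)
    then show ?thesis using assms(5,6) by simp
  next
    case False
    \<comment> \<open>The change of variables theorem speaks of finite measure only. An image of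
      finite measure would make the positive constant \<open>c\<close> integrable over
      \<open>S\<close>, hence \<open>S\<close> of finite measure; so infinite measure is preserved
      too.\<close>
    have "f ` S \<notin> lmeasurable"
    proof
      assume "f ` S \<in> lmeasurable"
      then have "((\<lambda>x. c) has_integral measure lebesgue (f ` S)) S" using * by blast
      then have "(\<lambda>x. c) integrable_on S" by blast
      then have "(\<lambda>x. 1 :: real) integrable_on S"
        using integrable_on_cmult_iff[of c "\<lambda>x. 1::real" S] assms(4) by simp
      with False show False by (simp add: lmeasurable_iff_integrable_on)
    qed
    with False S fS have "emeasure lebesgue S = \<infinity>" "emeasure lebesgue (f ` S) = \<infinity>"
      by (metis fmeasurableI infinity_ennreal_def less_top)+
    then show ?thesis using assms(4-6) by (simp add: ennreal_mult_top)
  qed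
qed

text \<open>Conjugating \<open>f\<close> with a relabelling of coordinates moves it to a
  well-ordered index type; this changes neither Lebesgue measure nor the Jacobian
  determinant.\<close>

lemma emeasure_lborel_image:
  fixes f :: "real ^ 'n::finite \<Rightarrow> real ^ 'n::_" and c :: real
  assumes "\<And>x. (f has_derivative f' x) (at x)" "inj f" "\<And>x. \<bar>det (matrix (f' x))\<bar> = c" "c > 0"
    "S \<in> sets borel" "f ` S \<in> sets borel"
  shows "emeasure lborel (f ` S) = c * emeasure lborel S"
proof -
  define h :: "'n enum_index \<Rightarrow> 'n" where "h = Rep_enum_index"
  have h: "bij h"
    unfolding h_def by (metis Abs_enum_index_inverse Rep_enum_index_inverse UNIV_I bijI')
  let ?r = "\<lambda>x::real^'n. (\<chi> i. x $ h i) :: real ^ 'n enum_index"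
  let ?s = "\<lambda>x::real^'n enum_index. (\<chi> i. x $ inv h i) :: real^'n"
  have sr: "?s (?r x) = x" "?r (?s y) = y" for x y
    using h by (auto simp: vec_eq_iff bij_is_surj surj_f_inv_f bij_is_inj)
  have linr: "bounded_linear ?r" and lins: "bounded_linear ?s"
    by (auto simp: linear_conv_bounded_linear[symmetric] linear_iff vec_eq_iff)
  have bor: "?r ` T \<in> sets borel" if "T \<in> sets borel" for T
  proof -
    have "?s \<in> borel \<rightarrow>\<^sub>M borel"
      by (intro borel_measurable_continuous_onI continuous_intros)
    moreover have "?r ` T = ?s -` T" using sr by (intro vimage_eq_image_inverse[symmetric])
    ultimately show ?thesis using that measurable_sets_borel by metis
  qed
  let ?f = "\<lambda>y. ?r (f (?s y))" and ?f' = "\<lambda>y v. ?r (f' (?s y) (?s v))"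
  have "emeasure lborel (?f ` ?r ` S) = c * emeasure lborel (?r ` S)"
  proof (rule emeasure_lborel_image_wellorder[where f' = ?f'])
    show "(?f has_derivative ?f' y) (at y)" for y
      using bounded_linear.has_derivative[OF linr
          has_derivative_compose[OF bounded_linear_imp_has_derivative[OF lins] assms(1)]]
      by simp
    show "inj ?f"
    proof (intro injI)
      fix x y assume "?f x = ?f y"
      then have "?s (?f x) = ?s (?f y)" by (rule arg_cong)
      then have "f (?s x) = f (?s y)" by (simp only: sr)
      then have "?s x = ?s y" by (rule injD[OF assms(2)])
      then have "?r (?s x) = ?r (?s y)" by (rule arg_cong)
      then show "x = y" by (simp only: sr)
    qed
    show "\<bar>det (matrix (?f' y))\<bar> = c" for y
    proof -
      \<comment> \<open>Axes go to axes, so the Jacobian matrix of the conjugated map is the old one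
        with relabelled rows and columns.\<close>
      have "?s (axis j 1) = axis (h j) 1" for j
      proof -
        have "inv h i = j \<longleftrightarrow> i = h j" for i
          using bij_inv_eq_iff[OF h] by metis
        then show ?thesis by (simp add: vec_eq_iff axis_def)
      qed
      then have "matrix (?f' y) = (\<chi> i j. matrix (f' (?s y)) $ h i $ h j)"
        by (simp add: matrix_def vec_eq_iff)
      then show ?thesis using det_reindex[OF h, of "matrix (f' (?s y))"] assms(3) by simp
    qed
    have "?f ` ?r ` S = ?r ` f ` S" using sr by (auto simp: image_image)
    then show "?f ` ?r ` S \<in> sets borel" "?r ` S \<in> sets borel" using bor assms(5,6) by auto
  qed (use assms in auto)
  moreover have "?f ` ?r ` S = ?r ` f ` S" using sr by (auto simp: image_image)
  ultimately show ?thesis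
    using emeasure_lborel_reindex[OF h assms(5)] emeasure_lborel_reindex[OF h assms(6)] by simp
qed


section \<open>Dilations\<close>

text \<open>\<open>C\<close> is the inverse of the matrix whose columns are the eigenvectors
  \<open>b j\<close>, so \<open>(C *v x) $ i\<close> is the \<open>i\<close>-th coordinate of
  \<open>x\<close> in the eigenbasis.\<close>

lemma diagonalisable_pos_basis:
  fixes A :: "real ^ 'n::finite \<Rightarrow> real ^ 'n"
  assumes "diagonalisable_pos A"
  obtains b :: "'n \<Rightarrow> real ^ 'n" and d :: "'n \<Rightarrow> real" and C :: "real ^ 'n ^ 'n"
  where "\<And>i. d i > 0" "\<And>i. A (b i) = d i *\<^sub>R b i" "linear A"
    "\<And>x. (\<Sum>i\<in>UNIV. (C *v x) $ i *\<^sub>R b i) = x"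
    "(\<chi> i j. b j $ i) ** C = mat 1"
proof -
  obtain B where B: "independent B" "span B = UNIV" "\<And>b. b \<in> B \<Longrightarrow> \<exists>\<nu>>0. A b = \<nu> *\<^sub>R b"
    and lin: "linear A"
    using assms by (auto simp: diagonalisable_pos_def)
  have "card B = CARD('n)"
    using dim_eq_card_independent[OF B(1)] B(2) by (metis dim_UNIV dim_span DIM_cart DIM_real mult.right_neutral)
  moreover have "finite B" using B(1) independent_imp_finite by blast
  ultimately obtain b :: "'n \<Rightarrow> real ^ 'n" where b: "bij_betw b UNIV B"
    using finite_same_card_bij[of "UNIV :: 'n set" B] by auto
  have "\<forall>i. \<exists>\<nu>>0. A (b i) = \<nu> *\<^sub>R b i" using B(3) b by (auto simp: bij_betw_def)
  then obtain d where d: "\<And>i. d i > 0" "\<And>i. A (b i) = d i *\<^sub>R b i" by metis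
  let ?P = "(\<chi> i j. b j $ i) :: real ^ 'n ^ 'n"
  have col: "column j ?P = b j" for j by (simp add: column_def vec_eq_iff)
  have "columns ?P = B"
    using b by (auto simp: columns_def col bij_betw_def)
  then have "vec.span (columns ?P) = UNIV"
    using B(2) by (simp add: span_vec_eq)
  then obtain C where C: "?P ** C = mat 1"
    using matrix_right_invertible_span_columns[of ?P] by blast
  have "(\<Sum>i\<in>UNIV. (C *v x) $ i *\<^sub>R b i) = x" for x
    using matrix_mult_sum[of ?P "C *v x"] C
    by (simp add: col matrix_vector_mul_assoc scalar_mult_eq_scaleR)
  from d(1,2) lin this C show ?thesis by (rule that)
qed

text \<open>A one-sided inverse of a square matrix is two-sided; here the product is used in the
  other order.\<close>

lemma dual_eigenbasis:
  fixes b :: "'n::finite \<Rightarrow> real ^ 'n" and C :: "real ^ 'n ^ 'n"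
  assumes "(\<chi> i j. b j $ i) ** C = mat 1"
  shows "C *v (\<Sum>i\<in>UNIV. y $ i *\<^sub>R b i) = y"
proof -
  let ?P = "(\<chi> i j. b j $ i) :: real ^ 'n ^ 'n"
  have "C ** ?P = mat 1" using assms matrix_left_right_inverse by blast
  moreover have "(\<Sum>i\<in>UNIV. y $ i *\<^sub>R b i) = ?P *v y"
    by (simp add: vec_eq_iff matrix_vector_mult_def mult.commute)
  ultimately show ?thesis by (simp add: matrix_vector_mul_assoc)
qed

text \<open>On an eigenvector the operator series becomes a scalar exponential series.\<close>

lemma lie_dilation_eigenbasis:
  fixes A :: "real ^ 'n::finite \<Rightarrow> real ^ 'n" and C :: "real ^ 'n ^ 'n"
  assumes "linear A" "\<And>i. A (b i) = d i *\<^sub>R b i"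
    "\<And>x. (\<Sum>i\<in>UNIV. (C *v x) $ i *\<^sub>R b i) = x"
  shows "lie_dilation A r x = (\<Sum>i\<in>UNIV. (exp (ln r * d i) * (C *v x) $ i) *\<^sub>R b i)"
proof -
  have pow: "((\<lambda>Y. ln r *\<^sub>R A Y) ^^ k) x = (\<Sum>i\<in>UNIV. ((ln r * d i) ^ k * (C *v x) $ i) *\<^sub>R b i)" for k
  proof (induction k)
    case 0 then show ?case using assms(3) by simp
  next
    case (Suc k)
    then show ?case
      by (simp add: linear_sum[OF assms(1)] linear_scale[OF assms(1)] assms(2) scaleR_sum_right
          mult_ac)
  qed
  have "(\<lambda>k. (ln r * d i) ^ k / fact k) sums exp (ln r * d i)" for i
    using exp_converges[of "ln r * d i"] by (simp add: divide_inverse mult.commute)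
  then have "(\<lambda>k. \<Sum>i\<in>UNIV. ((ln r * d i) ^ k / fact k * (C *v x) $ i) *\<^sub>R b i) sums
      (\<Sum>i\<in>UNIV. (exp (ln r * d i) * (C *v x) $ i) *\<^sub>R b i)"
    by (intro sums_sum sums_scaleR_left sums_mult2)
  moreover have "(1 / fact k) *\<^sub>R ((\<lambda>Y. ln r *\<^sub>R A Y) ^^ k) x
      = (\<Sum>i\<in>UNIV. ((ln r * d i) ^ k / fact k * (C *v x) $ i) *\<^sub>R b i)" for k
    unfolding pow by (simp add: scaleR_sum_right)
  ultimately show ?thesis
    unfolding lie_dilation_def by (simp add: sums_iff)
qed

text \<open>The map is similar to the diagonal matrix with entries \<open>e i\<close>.\<close>

lemma det_trace_eigenbasis:
  fixes b :: "'n::finite \<Rightarrow> real ^ 'n" and C :: "real ^ 'n ^ 'n"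
  assumes "(\<chi> i j. b j $ i) ** C = mat 1"
  shows "det (matrix (\<lambda>x. \<Sum>i\<in>UNIV. (e i * (C *v x) $ i) *\<^sub>R b i)) = (\<Prod>i\<in>UNIV. e i)"
    and "trace (matrix (\<lambda>x. \<Sum>i\<in>UNIV. (e i * (C *v x) $ i) *\<^sub>R b i)) = (\<Sum>i\<in>UNIV. e i)"
proof -
  let ?P = "(\<chi> i j. b j $ i) :: real ^ 'n ^ 'n" and ?D = "(\<chi> i j. if i = j then e i else 0) :: real ^ 'n ^ 'n"
  have col: "column j ?P = b j" for j by (simp add: column_def vec_eq_iff)
  have "?D *v y = (\<chi> i. e i * y $ i)" for y
    by (simp add: matrix_vector_mult_def vec_eq_iff if_distrib[of "\<lambda>z. z * _"] cong: if_cong)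
  then have "(\<lambda>x. \<Sum>i\<in>UNIV. (e i * (C *v x) $ i) *\<^sub>R b i) = (\<lambda>x. (?P ** ?D ** C) *v x)"
    by (simp add: matrix_vector_mul_assoc[symmetric] matrix_mult_sum[of ?P] col scalar_mult_eq_scaleR)
  then have m: "matrix (\<lambda>x. \<Sum>i\<in>UNIV. (e i * (C *v x) $ i) *\<^sub>R b i) = ?P ** ?D ** C"
    by simp
  have "det ?P * det C = 1" using assms by (metis det_I det_mul)
  moreover have "det ?D = (\<Prod>i\<in>UNIV. e i)" by (subst det_diagonal) auto
  ultimately show "det (matrix (\<lambda>x. \<Sum>i\<in>UNIV. (e i * (C *v x) $ i) *\<^sub>R b i)) = (\<Prod>i\<in>UNIV. e i)"
    unfolding m det_mul by (simp add: mult_ac)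
  have "C ** ?P = mat 1" using assms matrix_left_right_inverse by blast
  then have "trace (?P ** ?D ** C) = trace ?D"
    using trace_mul_sym[of "?P ** ?D" C] by (simp add: matrix_mul_assoc)
  then show "trace (matrix (\<lambda>x. \<Sum>i\<in>UNIV. (e i * (C *v x) $ i) *\<^sub>R b i)) = (\<Sum>i\<in>UNIV. e i)"
    unfolding m by (simp add: trace_def)
qed

context
  fixes A :: "real ^ 'n::finite \<Rightarrow> real ^ 'n"
  assumes A: "diagonalisable_pos A"
begin

lemma lie_dilation_powr:
  obtains b :: "'n \<Rightarrow> real ^ 'n" and d :: "'n \<Rightarrow> real" and C :: "real ^ 'n ^ 'n"
  where "\<And>i. d i > 0" "\<And>x. A x = (\<Sum>i\<in>UNIV. (d i * (C *v x) $ i) *\<^sub>R b i)"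
    "\<And>r x. r > 0 \<Longrightarrow> lie_dilation A r x = (\<Sum>i\<in>UNIV. (r powr d i * (C *v x) $ i) *\<^sub>R b i)"
    "\<And>x. (\<Sum>i\<in>UNIV. (C *v x) $ i *\<^sub>R b i) = x"
    "(\<chi> i j. b j $ i) ** C = mat 1"
proof -
  obtain b :: "'n \<Rightarrow> real ^ 'n" and d :: "'n \<Rightarrow> real" and C :: "real ^ 'n ^ 'n"
    where *: "\<And>i. d i > 0" "\<And>i. A (b i) = d i *\<^sub>R b i" "linear A"
    "\<And>x. (\<Sum>i\<in>UNIV. (C *v x) $ i *\<^sub>R b i) = x"
    "(\<chi> i j. b j $ i) ** C = mat 1"
    by (rule diagonalisable_pos_basis[OF A]) (rule that)
  have Ax: "A x = (\<Sum>i\<in>UNIV. (d i * (C *v x) $ i) *\<^sub>R b i)" for x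
  proof -
    have "A (\<Sum>i\<in>UNIV. (C *v x) $ i *\<^sub>R b i) = (\<Sum>i\<in>UNIV. (d i * (C *v x) $ i) *\<^sub>R b i)"
      by (simp add: linear_sum[OF *(3)] linear_scale[OF *(3)] *(2) mult.commute)
    then show ?thesis by (simp only: *(4))
  qed
  have Dx: "lie_dilation A r x = (\<Sum>i\<in>UNIV. (r powr d i * (C *v x) $ i) *\<^sub>R b i)" if "r > 0" for r x
    using lie_dilation_eigenbasis[OF *(3) *(2) *(4)] that by (simp add: powr_def mult.commute)
  show ?thesis using *(1) Ax Dx *(4,5) by (rule that)
qed

lemma lie_dilation_zero: "lie_dilation A r 0 = 0"
proof -
  have "linear A" using A by (simp add: diagonalisable_pos_def)
  then have "((\<lambda>Y. ln r *\<^sub>R A Y) ^^ k) 0 = 0" for k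
    by (induction k) (auto simp: linear_0)
  then show ?thesis by (simp add: lie_dilation_def)
qed

lemma lie_dilation_one: "lie_dilation A 1 x = x"
  by (rule lie_dilation_powr) simp

lemma lie_dilation_mult:
  assumes "r > 0" "s > 0"
  shows "lie_dilation A r (lie_dilation A s x) = lie_dilation A (r * s) x"
proof -
  obtain b :: "'n \<Rightarrow> real ^ 'n" and d :: "'n \<Rightarrow> real" and C :: "real ^ 'n ^ 'n"
    where *: "\<And>i. d i > 0" "\<And>x. A x = (\<Sum>i\<in>UNIV. (d i * (C *v x) $ i) *\<^sub>R b i)"
    "\<And>r x. r > 0 \<Longrightarrow> lie_dilation A r x = (\<Sum>i\<in>UNIV. (r powr d i * (C *v x) $ i) *\<^sub>R b i)"
    "\<And>x. (\<Sum>i\<in>UNIV. (C *v x) $ i *\<^sub>R b i) = x"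
    "(\<chi> i j. b j $ i) ** C = mat 1"
    by (rule lie_dilation_powr) (rule that)
  from dual_eigenbasis[OF *(5), of "\<chi> i. s powr d i * (C *v x) $ i"]
  have "C *v lie_dilation A s x = (\<chi> i. s powr d i * (C *v x) $ i)"
    using *(3) assms by simp
  then show ?thesis
    using *(3) assms by (simp add: powr_mult mult_ac)
qed

lemma linear_lie_dilation: "r > 0 \<Longrightarrow> linear (lie_dilation A r)"
  by (rule lie_dilation_powr)
    (simp add: linear_iff matrix_vector_right_distrib scaleR_add_left distrib_left sum.distrib
      scaleR_sum_right matrix_vector_mult_scaleR mult_ac)

text \<open>Positivity of the eigenvalues acts here: each coordinate is multiplied by
  \<open>r powr d i\<close> with \<open>d i > 0\<close>.\<close>

lemma lie_dilation_tendsto_zero: "((\<lambda>r. lie_dilation A r x) \<longlongrightarrow> 0) (at_right 0)"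
proof -
  obtain b :: "'n \<Rightarrow> real ^ 'n" and d :: "'n \<Rightarrow> real" and C :: "real ^ 'n ^ 'n"
    where *: "\<And>i. d i > 0" "\<And>x. A x = (\<Sum>i\<in>UNIV. (d i * (C *v x) $ i) *\<^sub>R b i)"
    "\<And>r x. r > 0 \<Longrightarrow> lie_dilation A r x = (\<Sum>i\<in>UNIV. (r powr d i * (C *v x) $ i) *\<^sub>R b i)"
    "\<And>x. (\<Sum>i\<in>UNIV. (C *v x) $ i *\<^sub>R b i) = x"
    "(\<chi> i j. b j $ i) ** C = mat 1"
    by (rule lie_dilation_powr) (rule that)
  have "((\<lambda>r. r powr d i) \<longlongrightarrow> 0 powr d i) (at_right 0)" for i
    using *(1)[of i] by (intro tendsto_powr2 tendsto_ident_at tendsto_const) (auto simp: eventually_at_filter)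
  then have "((\<lambda>r. \<Sum>i\<in>UNIV. (r powr d i * (C *v x) $ i) *\<^sub>R b i) \<longlongrightarrow>
     (\<Sum>i\<in>UNIV. (0 powr d i * (C *v x) $ i) *\<^sub>R b i)) (at_right 0)"
    by (intro tendsto_sum tendsto_scaleR tendsto_mult tendsto_const)
  moreover have "eventually (\<lambda>r. (\<Sum>i\<in>UNIV. (r powr d i * (C *v x) $ i) *\<^sub>R b i) = lie_dilation A r x) (at_right 0)"
    using *(3) by (auto simp: eventually_at_filter)
  ultimately show ?thesis using tendsto_cong by fastforce
qed

text \<open>In the eigenbasis \<open>r * d/dr\<close> multiplies \<open>r powr d i\<close> by
  \<open>d i\<close>, which is the action of \<open>A\<close>. So \<open>A\<close>, read as a vector
  field, generates the dilations.\<close>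

lemma lie_dilation_has_vector_derivative:
  assumes "r > 0"
  shows "((\<lambda>r. lie_dilation A r x) has_vector_derivative (1 / r) *\<^sub>R A (lie_dilation A r x)) (at r)"
proof -
  obtain b :: "'n \<Rightarrow> real ^ 'n" and d :: "'n \<Rightarrow> real" and C :: "real ^ 'n ^ 'n"
    where *: "\<And>i. d i > 0" "\<And>x. A x = (\<Sum>i\<in>UNIV. (d i * (C *v x) $ i) *\<^sub>R b i)"
    "\<And>r x. r > 0 \<Longrightarrow> lie_dilation A r x = (\<Sum>i\<in>UNIV. (r powr d i * (C *v x) $ i) *\<^sub>R b i)"
    "\<And>x. (\<Sum>i\<in>UNIV. (C *v x) $ i *\<^sub>R b i) = x"
    "(\<chi> i j. b j $ i) ** C = mat 1"
    by (rule lie_dilation_powr) (rule that)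
  from dual_eigenbasis[OF *(5), of "\<chi> i. r powr d i * (C *v x) $ i"]
  have C: "C *v lie_dilation A r x = (\<chi> i. r powr d i * (C *v x) $ i)"
    using *(3) assms by simp
  have "((\<lambda>r. \<Sum>i\<in>UNIV. (r powr d i * (C *v x) $ i) *\<^sub>R b i) has_vector_derivative
      (\<Sum>i\<in>UNIV. (d i * r powr (d i - 1) * (C *v x) $ i) *\<^sub>R b i)) (at r)"
    using assms
    by (intro has_vector_derivative_sum has_vector_derivative_scaleR[THEN has_vector_derivative_eq_rhs])
      (auto intro!: derivative_eq_intros simp: has_real_derivative_iff_has_vector_derivative[symmetric])
  also have "(\<Sum>i\<in>UNIV. (d i * r powr (d i - 1) * (C *v x) $ i) *\<^sub>R b i) = (1 / r) *\<^sub>R A (lie_dilation A r x)"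
    using assms by (simp add: *(2) C scaleR_sum_right powr_diff mult_ac)
  finally show ?thesis
    by (rule has_vector_derivative_transform_within_open[where S = "{0<..}"]) (use assms *(3) in auto)
qed

lemma continuous_on_lie_dilation:
  "continuous_on ({0<..} \<times> UNIV) (\<lambda>(r, x). lie_dilation A r x)"
proof -
  obtain b :: "'n \<Rightarrow> real ^ 'n" and d :: "'n \<Rightarrow> real" and C :: "real ^ 'n ^ 'n"
    where *: "\<And>i. d i > 0" "\<And>x. A x = (\<Sum>i\<in>UNIV. (d i * (C *v x) $ i) *\<^sub>R b i)"
    "\<And>r x. r > 0 \<Longrightarrow> lie_dilation A r x = (\<Sum>i\<in>UNIV. (r powr d i * (C *v x) $ i) *\<^sub>R b i)"
    "\<And>x. (\<Sum>i\<in>UNIV. (C *v x) $ i *\<^sub>R b i) = x"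
    "(\<chi> i j. b j $ i) ** C = mat 1"
    by (rule lie_dilation_powr) (rule that)
  have "continuous_on ({0<..} \<times> UNIV) (\<lambda>p. \<Sum>i\<in>UNIV. (fst p powr d i * (C *v snd p) $ i) *\<^sub>R b i)"
    by (intro continuous_intros bounded_linear.continuous_on[OF matrix_vector_mul_bounded_linear]) auto
  then show ?thesis
    by (rule continuous_on_eq) (auto simp: *(3))
qed

text \<open>The exponents \<open>d i\<close> of the diagonal entries add up to the trace of
  \<open>A\<close>. This is the source of every power of \<open>r\<close> with exponent
  \<open>Q\<close> or \<open>- Q\<close> below.\<close>

lemma det_lie_dilation:
  assumes "r > 0"
  shows "det (matrix (lie_dilation A r)) = r powr homogeneous_dimension A"
proof -
  obtain b :: "'n \<Rightarrow> real ^ 'n" and d :: "'n \<Rightarrow> real" and C :: "real ^ 'n ^ 'n"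
    where *: "\<And>i. d i > 0" "\<And>x. A x = (\<Sum>i\<in>UNIV. (d i * (C *v x) $ i) *\<^sub>R b i)"
    "\<And>r x. r > 0 \<Longrightarrow> lie_dilation A r x = (\<Sum>i\<in>UNIV. (r powr d i * (C *v x) $ i) *\<^sub>R b i)"
    "\<And>x. (\<Sum>i\<in>UNIV. (C *v x) $ i *\<^sub>R b i) = x"
    "(\<chi> i j. b j $ i) ** C = mat 1"
    by (rule lie_dilation_powr) (rule that)
  have "lie_dilation A r = (\<lambda>x. \<Sum>i\<in>UNIV. (r powr d i * (C *v x) $ i) *\<^sub>R b i)"
    "A = (\<lambda>x. \<Sum>i\<in>UNIV. (d i * (C *v x) $ i) *\<^sub>R b i)" using *(2,3) assms by auto
  then have "det (matrix (lie_dilation A r)) = (\<Prod>i\<in>UNIV. r powr d i)"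
    "trace (matrix A) = (\<Sum>i\<in>UNIV. d i)"
    using det_trace_eigenbasis[OF *(5)] by auto
  then show ?thesis using assms by (simp add: homogeneous_dimension_def powr_sum)
qed

end


section \<open>Left-invariant fields in exponential coordinates\<close>

lemma has_vector_derivative_compose:
  assumes "(f has_vector_derivative f') (at t)" "(g has_derivative g') (at p)" "f t = p"
  shows "((\<lambda>s. g (f s)) has_vector_derivative g' f') (at t)"
proof -
  have "(g has_derivative g') (at (f t) within range f)"
    using assms(2,3) has_derivative_at_withinI by blast
  from vector_derivative_diff_chain_within[OF assms(1) this] show ?thesis by (simp add: o_def)
qed

locale homogeneous_lie_group =
  fixes \<A> :: "('g::{group_add, t2_space, second_countable_topology}, real ^ 'n::finite) chart set"
    and \<Theta> :: "real ^ 'n \<Rightarrow> ('g \<Rightarrow> real) \<Rightarrow> 'g \<Rightarrow> real"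
    and E :: "real ^ 'n \<Rightarrow> 'g"
    and A :: "real ^ 'n \<Rightarrow> real ^ 'n"
  assumes hom: "homogeneous_group \<A> \<Theta> E A"
begin

abbreviation lg :: "'g \<Rightarrow> real ^ 'n" where
  "lg \<equiv> inv E"

lemma bij_E: "bij E"
  using hom by (simp add: homogeneous_group_def diffeomorphism_def)

lemma lg_E [simp]: "lg (E p) = p"
  using bij_E by (simp add: bij_is_inj)

lemma E_lg [simp]: "E (lg x) = x"
  using bij_E by (simp add: bij_is_surj surj_f_inv_f)

lemma continuous_on_E: "continuous_on S E"
  by (rule continuous_on_subset[of UNIV])
    (use hom in \<open>simp_all add: homogeneous_group_def diffeomorphism_def smooth_map_def\<close>)

lemma continuous_on_lg: "continuous_on S lg"
  by (rule continuous_on_subset[of UNIV])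
    (use hom in \<open>simp_all add: homogeneous_group_def diffeomorphism_def smooth_map_def\<close>)

text \<open>Makes \<open>lg\<close> a single global chart. Composing with the coordinate expressions
  of \<open>E\<close> and \<open>lg\<close> passes between it and the charts of the atlas; the
  preimages of the chart domains are open and cover the space, so the local statements add
  up.\<close>

lemma smooth_fun_iff:
  fixes f :: "'g \<Rightarrow> 'b::euclidean_space"
  shows "smooth_fun \<A> f \<longleftrightarrow> smooth_on UNIV (\<lambda>p. f (E p))"
proof
  have atlas: "smooth_atlas \<A>" using hom by (simp add: homogeneous_group_def lie_group_def)
  have E: "smooth_map euclidean_atlas \<A> E" and lg: "smooth_map \<A> euclidean_atlas lg"
    using hom by (simp_all add: homogeneous_group_def diffeomorphism_def)
  {
    assume f: "smooth_fun \<A> f"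
    have chart: "open (E -` U) \<and> Ck_on k (E -` U) (\<lambda>p. f (E p))" if U: "(U, \<phi>) \<in> \<A>" for U \<phi> k
    proof
      have "open U" "open (\<phi> ` U)" and hm: "homeomorphism U (\<phi> ` U) \<phi> (inv_into U \<phi>)"
        using atlas U by (auto simp: smooth_atlas_def)
      show op: "open (E -` U)"
        using \<open>open U\<close> continuous_on_E[of UNIV] by (simp add: open_vimage)
      have "Ck_on k (E -` U) (\<lambda>p. \<phi> (E p))"
        using E U by (auto simp: smooth_map_def euclidean_atlas_def smooth_on_def o_def inv_id[unfolded id_def] id_def)
      moreover have "Ck_on k (\<phi> ` U) (\<lambda>y. f (inv_into U \<phi> y))"
        using f U by (auto simp: smooth_map_def euclidean_atlas_def smooth_on_def o_def)
      ultimately have "Ck_on k (E -` U) (\<lambda>p. f (inv_into U \<phi> (\<phi> (E p))))"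
        using \<open>open (\<phi> ` U)\<close> op by - (rule Ck_on_compose[where T = "\<phi> ` U" and f = "\<lambda>p. \<phi> (E p)"
              and g = "\<lambda>y. f (inv_into U \<phi> y)"], auto)
      then show "Ck_on k (E -` U) (\<lambda>p. f (E p))"
        using hm by (subst Ck_on_cong[OF op, of _ "\<lambda>p. f (inv_into U \<phi> (\<phi> (E p)))"])
          (auto simp: homeomorphism_def)
    qed
    have "Ck_on k (\<Union>((\<lambda>(U, \<phi>). E -` U) ` \<A>)) (\<lambda>p. f (E p))" for k
      using chart by (intro Ck_on_Union) auto
    moreover have "\<Union>((\<lambda>(U, \<phi>). E -` U) ` \<A>) = UNIV"
      using atlas by (fastforce simp: smooth_atlas_def)
    ultimately show "smooth_on UNIV (\<lambda>p. f (E p))" by (simp add: smooth_on_def)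
  next
    assume f: "smooth_on UNIV (\<lambda>p. f (E p))"
    have "continuous_on UNIV (\<lambda>p. f (E p))"
      using f by (metis Ck_on.simps(1) smooth_on_def)
    then have "continuous_on UNIV (\<lambda>x. f (E (lg x)))"
      by (rule continuous_on_compose2[OF _ continuous_on_lg]) auto
    moreover have "Ck_on k (\<phi> ` U) (\<lambda>y. f (inv_into U \<phi> y))" if U: "(U, \<phi>) \<in> \<A>" for U \<phi> k
    proof -
      have "open (\<phi> ` U)" using atlas U by (auto simp: smooth_atlas_def)
      moreover have "Ck_on k (\<phi> ` U) (\<lambda>y. lg (inv_into U \<phi> y))"
        using lg U by (auto simp: smooth_map_def euclidean_atlas_def smooth_on_def o_def)
      ultimately have "Ck_on k (\<phi> ` U) (\<lambda>y. f (E (lg (inv_into U \<phi> y))))"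
        using f by - (rule Ck_on_compose[where T = UNIV and g = "\<lambda>p. f (E p)"
              and f = "\<lambda>y. lg (inv_into U \<phi> y)"], auto simp: smooth_on_def)
      then show ?thesis by simp
    qed
    ultimately show "smooth_fun \<A> f"
      by (auto simp: smooth_map_def euclidean_atlas_def smooth_on_def o_def)
  }
qed

section \<open>Fields, one-parameter subgroups and the left-invariant frame\<close>

lemma smooth_fun_lg: "smooth_fun \<A> (\<lambda>x. lg x $ i)"
  unfolding smooth_fun_iff smooth_on_def lg_E
  by (intro allI Ck_on_bounded_linear open_UNIV bounded_linear_vec_nth)

lemma \<Theta>_left_invariant: "\<Theta> X \<in> left_invariant_fields \<A>"
  using hom by (auto simp: homogeneous_group_def lie_algebra_iso_def bij_betw_def)

lemma \<Theta>_add: "\<Theta> (X + Y) f x = \<Theta> X f x + \<Theta> Y f x"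
  using hom by (simp add: homogeneous_group_def lie_algebra_iso_def)

lemma \<Theta>_scaleR: "\<Theta> (c *\<^sub>R X) f x = c * \<Theta> X f x"
  using hom by (simp add: homogeneous_group_def lie_algebra_iso_def)

lemma smooth_fun_\<Theta>: "smooth_fun \<A> f \<Longrightarrow> smooth_fun \<A> (\<Theta> X f)"
  using \<Theta>_left_invariant[of X] by (simp add: left_invariant_fields_def)

lemma E_one_parameter: "one_parameter_subgroup \<A> \<Theta> X (\<lambda>t. E (t *\<^sub>R X))"
  using hom by (simp add: homogeneous_group_def is_lie_exp_def)

lemma E_add_scaleR: "E ((s + t) *\<^sub>R X) = E (s *\<^sub>R X) + E (t *\<^sub>R X)"
  using E_one_parameter[of X] unfolding one_parameter_subgroup_def by blast

lemma E_0 [simp]: "E 0 = 0"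
  using E_add_scaleR[of 0 0 0] add_left_cancel[of "E 0" "E 0" 0] by simp

lemma lg_0 [simp]: "lg 0 = 0"
  using lg_E[of 0] by simp

lemma E_uminus: "E (- X) = - E X"
  using E_add_scaleR[of "-1" 1 X] by (simp add: eq_neg_iff_add_eq_0)

lemma \<Theta>_has_derivative:
  "smooth_fun \<A> f \<Longrightarrow> ((\<lambda>s. f (E (s *\<^sub>R X))) has_real_derivative \<Theta> X f (E (t *\<^sub>R X))) (at t)"
  using E_one_parameter[of X] unfolding one_parameter_subgroup_def by blast

text \<open>The vector at \<open>E p\<close> of the left-invariant field named \<open>X\<close>, in
  exponential coordinates. Equivalently, the differential at the origin of left translation by
  \<open>E p\<close>, applied to \<open>X\<close>.\<close>

definition frame :: "real ^ 'n \<Rightarrow> real ^ 'n \<Rightarrow> real ^ 'n" where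
  "frame p X = (\<chi> i. \<Theta> X (\<lambda>x. lg x $ i) (E p))"

lemma linear_frame: "linear (frame p)"
  by (simp add: linear_iff frame_def \<Theta>_add \<Theta>_scaleR vec_eq_iff)

text \<open>In exponential coordinates the one-parameter subgroup of \<open>X\<close> is the line
  \<open>t X\<close>, whose velocity is \<open>X\<close> at all times.\<close>

lemma frame_ray: "frame (t *\<^sub>R X) X = X"
proof -
  have "\<Theta> X (\<lambda>x. lg x $ i) (E (t *\<^sub>R X)) = X $ i" for i
  proof (rule DERIV_unique)
    show "((\<lambda>s. lg (E (s *\<^sub>R X)) $ i) has_real_derivative \<Theta> X (\<lambda>x. lg x $ i) (E (t *\<^sub>R X))) (at t)"
      by (rule \<Theta>_has_derivative[OF smooth_fun_lg])
    show "((\<lambda>s. lg (E (s *\<^sub>R X)) $ i) has_real_derivative X $ i) (at t)"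
      by (auto intro!: derivative_eq_intros)
  qed
  then show ?thesis by (simp add: frame_def vec_eq_iff)
qed

lemma frame_0 [simp]: "frame 0 X = X"
  using frame_ray[of 0 X] by simp

definition coord_mult :: "real ^ 'n \<Rightarrow> real ^ 'n \<Rightarrow> real ^ 'n" where
  "coord_mult p q = lg (E p + E q)"

text \<open>A left-invariant field would vanish on a coordinate with a non-smooth translate.\<close>

lemma smooth_on_coord_mult: "smooth_on UNIV (coord_mult a)"
proof -
  have "smooth_fun \<A> (\<lambda>x. lg (E a + x) $ i)" for i
  proof (rule ccontr)
    let ?X = "axis i 1 :: real ^ 'n"
    assume "\<not> smooth_fun \<A> (\<lambda>x. lg (E a + x) $ i)"
    then have "\<Theta> ?X (\<lambda>x. lg (E a + x) $ i) = (\<lambda>_. 0)"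
      using \<Theta>_left_invariant[of ?X] unfolding left_invariant_fields_def by blast
    moreover have "\<Theta> ?X (\<lambda>x. lg (E a + x) $ i) = (\<lambda>x. \<Theta> ?X (\<lambda>x. lg x $ i) (E a + x))"
      using \<Theta>_left_invariant[of ?X] smooth_fun_lg[of i] unfolding left_invariant_fields_def by blast
    ultimately have "\<Theta> ?X (\<lambda>x. lg x $ i) (E a + x) = 0" for x by metis
    \<comment> \<open>This point is carried to the identity, where \<open>frame\<close> is the
      identity map and component \<open>i\<close> of the axis is \<open>1\<close>.\<close>
    from this[of "- E a"] have "frame 0 ?X $ i = 0" by (simp add: frame_def)
    then show False by simp
  qed
  then have "Ck_on k UNIV (\<lambda>p. coord_mult a p $ i)" for i k
    by (simp add: smooth_fun_iff smooth_on_def coord_mult_def)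
  then show ?thesis
    unfolding smooth_on_def
    by - (intro allI, rule Ck_on_componentwise, auto simp: Basis_vec_def inner_axis)
qed

lemma smooth_fun_translate:
  assumes "smooth_fun \<A> f" shows "smooth_fun \<A> (\<lambda>x. f (a + x))"
proof -
  have "Ck_on k UNIV (\<lambda>p. f (E (coord_mult (lg a) p)))" for k
    using assms smooth_on_coord_mult[of "lg a"]
    by - (rule Ck_on_compose[where T = UNIV and f = "coord_mult (lg a)" and g = "\<lambda>p. f (E p)"],
      auto simp: smooth_fun_iff smooth_on_def)
  then show ?thesis by (simp add: smooth_fun_iff smooth_on_def coord_mult_def)
qed

text \<open>Left translates of a one-parameter subgroup are integral curves of the same field. This
  makes the value of a field available at every point, not only along rays.\<close>

lemma \<Theta>_has_derivative_translate:
  assumes "smooth_fun \<A> f"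
  shows "((\<lambda>s. f (a + E (s *\<^sub>R X))) has_real_derivative \<Theta> X f (a + E (t *\<^sub>R X))) (at t)"
proof -
  have "\<Theta> X (\<lambda>x. f (a + x)) = (\<lambda>x. \<Theta> X f (a + x))"
    using \<Theta>_left_invariant[of X] assms unfolding left_invariant_fields_def by blast
  then show ?thesis using \<Theta>_has_derivative[OF smooth_fun_translate[OF assms], of a X t] by metis
qed

lemma lg_translate_derivative:
  "((\<lambda>s. lg (a + E (s *\<^sub>R X))) has_vector_derivative frame (lg a) X) (at 0)"
proof -
  have "((\<lambda>s. lg (a + E (s *\<^sub>R X)) $ i) has_real_derivative frame (lg a) X $ i) (at 0)" for i
    using \<Theta>_has_derivative_translate[OF smooth_fun_lg, where t = 0] by (simp add: frame_def)
  then show ?thesis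
    unfolding has_vector_derivative_def
    by (subst has_derivative_componentwise_within)
      (auto simp: Basis_vec_def inner_axis has_field_derivative_def mult_commute_abs)
qed

lemma smooth_on_differentiable: "smooth_on UNIV F \<Longrightarrow> F differentiable (at p)"
  unfolding smooth_on_def by (drule spec[of _ 1]) simp

lemma smooth_on_has_derivative:
  "smooth_on UNIV F \<Longrightarrow> (F has_derivative frechet_derivative F (at p)) (at p)"
  using smooth_on_differentiable frechet_derivative_works by blast

text \<open>The derivative of \<open>f\<close> along the integral curve through \<open>E p\<close>
  is computed twice: by the field, and by the chain rule in coordinates.\<close>

lemma \<Theta>_eq_frame:
  assumes "smooth_fun \<A> f"
  shows "\<Theta> X f (E p) = frechet_derivative (\<lambda>q. f (E q)) (at p) (frame p X)"
proof -
  let ?F = "\<lambda>q. f (E q)"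
  have "((\<lambda>s. ?F (lg (E p + E (s *\<^sub>R X)))) has_vector_derivative
      frechet_derivative ?F (at p) (frame p X)) (at 0)"
    using has_vector_derivative_compose[OF lg_translate_derivative[of "E p" X]
        smooth_on_has_derivative[OF assms[unfolded smooth_fun_iff], of p]] by simp
  moreover have "((\<lambda>s. f (E p + E (s *\<^sub>R X))) has_vector_derivative \<Theta> X f (E p)) (at 0)"
    using \<Theta>_has_derivative_translate[OF assms, of "E p" X 0]
    by (simp add: has_real_derivative_iff_has_vector_derivative)
  ultimately show ?thesis by (simp add: vector_derivative_unique_at)
qed

text \<open>By associativity, left translation by \<open>a\<close> maps the integral curve through
  \<open>p\<close> to the one through the product; compare velocities at time
  \<open>0\<close>.\<close>

lemma frame_coord_mult: "frechet_derivative (coord_mult a) (at p) (frame p X) = frame (coord_mult a p) X"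
proof -
  have "((\<lambda>s. coord_mult a (lg (E p + E (s *\<^sub>R X)))) has_vector_derivative
      frechet_derivative (coord_mult a) (at p) (frame p X)) (at 0)"
    using has_vector_derivative_compose[OF lg_translate_derivative[of "E p" X]
        smooth_on_has_derivative[OF smooth_on_coord_mult, of a p]] by simp
  moreover have "((\<lambda>s. coord_mult a (lg (E p + E (s *\<^sub>R X)))) has_vector_derivative frame (coord_mult a p) X) (at 0)"
    using lg_translate_derivative[of "E a + E p" X] by (simp add: coord_mult_def add.assoc)
  ultimately show ?thesis by (rule vector_derivative_unique_at)
qed

text \<open>Translation by the inverse of \<open>p\<close> carries the frame at \<open>p\<close> to
  the frame at the origin, which is the identity.\<close>

lemma inj_frame: "frame p X = 0 \<Longrightarrow> X = 0"
proof -
  assume 0: "frame p X = 0"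
  have "coord_mult (- p) p = 0" by (simp add: coord_mult_def E_uminus)
  then have "frechet_derivative (coord_mult (- p)) (at p) 0 = X"
    using frame_coord_mult[of "- p" p X] 0 by simp
  then show "X = 0"
    using linear_0[OF has_derivative_linear[OF smooth_on_has_derivative[OF smooth_on_coord_mult]]] by simp
qed

lemma smooth_on_frame: "smooth_on UNIV (\<lambda>p. frame p X)"
  unfolding smooth_on_def
  using smooth_fun_\<Theta>[OF smooth_fun_lg, of X]
  by - (intro allI, rule Ck_on_componentwise,
      auto simp: Basis_vec_def inner_axis frame_def smooth_fun_iff smooth_on_def)

end


section \<open>The Jacobian of left translations\<close>

lemma differentiable_det:
  fixes B :: "'a::real_normed_vector \<Rightarrow> real ^ 'n::finite ^ 'n"
  assumes "\<And>i j. (\<lambda>t. B t $ i $ j) differentiable (at x)"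
  shows "(\<lambda>t. det (B t)) differentiable (at x)"
proof -
  have "(\<lambda>t. \<Prod>i\<in>I. B t $ i $ p i) differentiable (at x)" for I p
    by (induction I rule: infinite_finite_induct) (use assms in auto)
  then show ?thesis
    unfolding det_def by (intro differentiable_sum differentiable_mult) auto
qed

lemma linear_axis_expansion:
  fixes L :: "real ^ 'n::finite \<Rightarrow> 'b::real_vector"
  assumes "linear L" shows "L Z = (\<Sum>j\<in>UNIV. Z $ j *\<^sub>R L (axis j 1))"
proof -
  have "L (\<Sum>j\<in>UNIV. Z $ j *\<^sub>R axis j 1) = (\<Sum>j\<in>UNIV. Z $ j *\<^sub>R L (axis j 1))"
    by (simp add: linear_sum[OF assms] linear_scale[OF assms])
  moreover have "(\<Sum>j\<in>UNIV. Z $ j *\<^sub>R axis j 1) = Z"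
    using basis_expansion[of Z] by (simp add: scalar_mult_eq_scaleR)
  ultimately show ?thesis by simp
qed

text \<open>An energy estimate: with \<open>C\<close> bounding \<open>B\<close>, the weight
  \<open>exp (- 2 C t)\<close> absorbs the growth of the squared norm, so the product is
  nonincreasing and starts at \<open>0\<close>.\<close>

lemma linear_ode_zero:
  fixes Z :: "real \<Rightarrow> 'a::euclidean_space"
  assumes "linear B" "\<And>t. (Z has_vector_derivative - B (Z t)) (at t)" "Z 0 = 0" "t \<ge> 0"
  shows "Z t = 0"
proof -
  obtain C where C: "C > 0" "\<And>z. norm (B z) \<le> norm z * C"
    using bounded_linear.pos_bounded[OF linear_conv_bounded_linear[THEN iffD1, OF assms(1)]] by blast
  let ?g = "\<lambda>t. exp (- 2 * C * t) * (Z t \<bullet> Z t)"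
  have "?g t \<le> ?g 0"
  proof (rule DERIV_nonpos_imp_nonincreasing[OF assms(4)])
    fix s :: real
    have "(?g has_real_derivative exp (- 2 * C * s) * (- 2 * C * (Z s \<bullet> Z s) - 2 * (B (Z s) \<bullet> Z s))) (at s)"
    proof -
      have "((\<lambda>t. Z t \<bullet> Z t) has_real_derivative (- 2 * (B (Z s) \<bullet> Z s))) (at s)"
        using bounded_bilinear.has_vector_derivative[OF bounded_bilinear_inner assms(2)[of s] assms(2)[of s]]
        by (simp add: has_real_derivative_iff_has_vector_derivative inner_commute)
      then show ?thesis
        by (auto intro!: derivative_eq_intros simp: algebra_simps)
    qed
    moreover have "- 2 * C * (Z s \<bullet> Z s) - 2 * (B (Z s) \<bullet> Z s) \<le> 0"
    proof -
      have "\<bar>B (Z s) \<bullet> Z s\<bar> \<le> norm (B (Z s)) * norm (Z s)" by (rule Cauchy_Schwarz_ineq2)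
      also have "\<dots> \<le> (norm (Z s) * C) * norm (Z s)" by (intro mult_right_mono C(2)) simp
      also have "\<dots> = C * (Z s \<bullet> Z s)" by (simp add: power2_norm_eq_inner[symmetric] power2_eq_square)
      finally show ?thesis by linarith
    qed
    ultimately show "\<exists>y. (?g has_real_derivative y) (at s) \<and> y \<le> 0"
      by (meson exp_ge_zero mult_nonneg_nonpos)
  qed
  then have "exp (- 2 * C * t) * (Z t \<bullet> Z t) \<le> 0" using assms(3) by simp
  then have "\<not> 0 < Z t \<bullet> Z t" by (metis exp_gt_zero mult_pos_pos not_less)
  then show ?thesis by simp
qed

context homogeneous_lie_group
begin

lemma
  fixes f g :: "'g \<Rightarrow> real"
  assumes "smooth_fun \<A> f" "smooth_fun \<A> g"
  shows smooth_fun_add: "smooth_fun \<A> (\<lambda>x. f x + g x)"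
    and smooth_fun_mult: "smooth_fun \<A> (\<lambda>x. f x * g x)"
    and smooth_fun_diff: "smooth_fun \<A> (\<lambda>x. f x - g x)"
proof -
  show "smooth_fun \<A> (\<lambda>x. f x + g x)" "smooth_fun \<A> (\<lambda>x. f x * g x)"
    using assms by (auto intro!: Ck_on_add Ck_on_bilinear[OF _ bounded_bilinear_mult] simp: smooth_fun_iff smooth_on_def)
  have "Ck_on k UNIV (\<lambda>x. f (E x) + (- 1) * g (E x))" for k
    using assms by (intro Ck_on_add Ck_on_linear_compose[OF _ bounded_linear_mult_right]) (auto simp: smooth_fun_iff smooth_on_def)
  then show "smooth_fun \<A> (\<lambda>x. f x - g x)" by (simp add: smooth_fun_iff smooth_on_def)
qed

lemma smooth_fun_zero: "smooth_fun \<A> (\<lambda>_. 0 :: real)"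
  unfolding smooth_fun_iff smooth_on_def by (intro allI Ck_on_const open_UNIV)

lemma \<Theta>_nonsmooth: "\<not> smooth_fun \<A> f \<Longrightarrow> \<Theta> X f = (\<lambda>_. 0)"
  and \<Theta>_fun_add: "smooth_fun \<A> f \<Longrightarrow> smooth_fun \<A> g \<Longrightarrow> \<Theta> X (\<lambda>x. f x + g x) = (\<lambda>x. \<Theta> X f x + \<Theta> X g x)"
  and \<Theta>_fun_cmult: "smooth_fun \<A> f \<Longrightarrow> \<Theta> X (\<lambda>x. c * f x) = (\<lambda>x. c * \<Theta> X f x)"
  and \<Theta>_fun_mult: "smooth_fun \<A> f \<Longrightarrow> smooth_fun \<A> g \<Longrightarrow>
        \<Theta> X (\<lambda>x. f x * g x) = (\<lambda>x. f x * \<Theta> X g x + g x * \<Theta> X f x)"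
  and \<Theta>_fun_translate: "smooth_fun \<A> f \<Longrightarrow> \<Theta> X (\<lambda>x. f (a + x)) = (\<lambda>x. \<Theta> X f (a + x))"
  using \<Theta>_left_invariant[of X] unfolding left_invariant_fields_def mem_Collect_eq by blast+

lemma \<Theta>_zero: "\<Theta> X (\<lambda>_. 0) = (\<lambda>_. 0)"
  using \<Theta>_fun_cmult[OF smooth_fun_zero, of X 0] by simp

text \<open>In the product rule the mixed first-order terms are symmetric in the two fields and
  cancel. On a non-smooth function both compositions are zero by the normalisation of
  fields.\<close>

lemma commutator_left_invariant:
  "(\<lambda>f x. \<Theta> X (\<Theta> Y f) x - \<Theta> Y (\<Theta> X f) x) \<in> left_invariant_fields \<A>"
  unfolding left_invariant_fields_def mem_Collect_eq
  by (intro conjI allI impI)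
    (simp_all add: \<Theta>_nonsmooth \<Theta>_zero \<Theta>_fun_add \<Theta>_fun_cmult \<Theta>_fun_mult \<Theta>_fun_translate
      smooth_fun_add smooth_fun_mult smooth_fun_diff smooth_fun_\<Theta> fun_eq_iff algebra_simps)

text \<open>The bracket is a value of \<open>inv \<Theta>\<close>, meaningful only on the range of
  \<open>\<Theta>\<close>; the commutator lies there because it is a left-invariant field.\<close>

lemma \<Theta>_lie_bracket: "\<Theta> (lie_bracket \<Theta> X Y) = (\<lambda>f x. \<Theta> X (\<Theta> Y f) x - \<Theta> Y (\<Theta> X f) x)"
proof -
  have "range \<Theta> = left_invariant_fields \<A>"
    using hom by (simp add: homogeneous_group_def lie_algebra_iso_def bij_betw_def)
  then show ?thesis
    using commutator_left_invariant[of X Y] unfolding lie_bracket_def by (intro f_inv_into_f) simp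
qed

section \<open>Derivatives of the frame and the bracket in coordinates\<close>

definition frame_deriv :: "real ^ 'n \<Rightarrow> real ^ 'n \<Rightarrow> real ^ 'n \<Rightarrow> real ^ 'n" where
  "frame_deriv p u Z = frechet_derivative (\<lambda>q. frame q Z) (at p) u"

lemma frame_has_derivative: "((\<lambda>q. frame q Z) has_derivative (\<lambda>u. frame_deriv p u Z)) (at p)"
  using smooth_on_has_derivative[OF smooth_on_frame] by (simp add: frame_deriv_def)

lemma linear_frame_deriv1: "linear (\<lambda>u. frame_deriv p u Z)"
  using frame_has_derivative by (rule has_derivative_linear)

lemma linear_frame_deriv2: "linear (frame_deriv p u)"
proof -
  have "(\<lambda>u. frame_deriv p u (Y + Z)) = (\<lambda>u. frame_deriv p u Y + frame_deriv p u Z)" for Y Z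
    using has_derivative_unique[OF frame_has_derivative[of "Y + Z"]]
      has_derivative_add[OF frame_has_derivative[of Y p] frame_has_derivative[of Z p]]
    by (simp add: linear_add[OF linear_frame])
  moreover have "(\<lambda>u. frame_deriv p u (c *\<^sub>R Y)) = (\<lambda>u. c *\<^sub>R frame_deriv p u Y)" for c Y
    using has_derivative_unique[OF frame_has_derivative[of "c *\<^sub>R Y"]]
      has_derivative_scaleR_right[OF frame_has_derivative[of Y p]]
    by (simp add: linear_scale[OF linear_frame])
  ultimately show ?thesis
    unfolding linear_iff by meson
qed

text \<open>Apply the commutator to the coordinate functions: \<open>\<Theta> Y\<close> sends a
  coordinate to a component of the frame, and \<open>\<Theta> X\<close> differentiates that
  component in the direction \<open>frame p X\<close>.\<close>

lemma frame_lie_bracket: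
  "frame p (lie_bracket \<Theta> X Y) = frame_deriv p (frame p X) Y - frame_deriv p (frame p Y) X"
proof -
  have *: "\<Theta> X (\<Theta> Y (\<lambda>x. lg x $ i)) (E p) = frame_deriv p (frame p X) Y $ i" for X Y i
  proof -
    have "((\<lambda>q. frame q Y $ i) has_derivative (\<lambda>u. frame_deriv p u Y $ i)) (at p)"
      by (intro bounded_linear.has_derivative[OF bounded_linear_vec_nth] frame_has_derivative)
    then have "frechet_derivative (\<lambda>q. frame q Y $ i) (at p) = (\<lambda>u. frame_deriv p u Y $ i)"
      by (rule frechet_derivative_at[symmetric])
    then show ?thesis
      using \<Theta>_eq_frame[OF smooth_fun_\<Theta>[OF smooth_fun_lg], of X Y i p] by (simp add: frame_def)
  qed
  show ?thesis
    unfolding vec_eq_iff by (simp add: frame_def[of p "lie_bracket \<Theta> X Y"] \<Theta>_lie_bracket *)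
qed

text \<open>At the origin the frame is the identity, so there the coordinate formula yields the
  bracket itself.\<close>

lemma linear_lie_bracket: "linear (lie_bracket \<Theta> X)"
proof -
  have "lie_bracket \<Theta> X = (\<lambda>Y. frame_deriv 0 X Y - frame_deriv 0 Y X)"
    using frame_lie_bracket[of 0 X] by auto
  then show ?thesis
    using linear_compose_sub[OF linear_frame_deriv2 linear_frame_deriv1] by simp
qed

text \<open>Expanding \<open>K\<close> in the axes leaves products of a scalar and a frame vector
  with fixed algebra element, each differentiable along the curve.\<close>

lemma frame_product_rule:
  assumes "(\<gamma> has_vector_derivative \<gamma>') (at t)" "(K has_vector_derivative K') (at t)"
  shows "((\<lambda>s. frame (\<gamma> s) (K s)) has_vector_derivative
           frame_deriv (\<gamma> t) \<gamma>' (K t) + frame (\<gamma> t) K') (at t)"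
proof -
  have K: "((\<lambda>s. K s $ j) has_vector_derivative K' $ j) (at t)" for j
    using bounded_linear.has_vector_derivative[OF bounded_linear_vec_nth assms(2)] .
  have "((\<lambda>s. frame (\<gamma> s) Z) has_vector_derivative frame_deriv (\<gamma> t) \<gamma>' Z) (at t)" for Z
    by (rule has_vector_derivative_compose[OF assms(1) frame_has_derivative refl])
  then have "((\<lambda>s. \<Sum>j\<in>UNIV. K s $ j *\<^sub>R frame (\<gamma> s) (axis j 1)) has_vector_derivative
     (\<Sum>j\<in>UNIV. K t $ j *\<^sub>R frame_deriv (\<gamma> t) \<gamma>' (axis j 1) + K' $ j *\<^sub>R frame (\<gamma> t) (axis j 1))) (at t)"
    using K by (intro has_vector_derivative_sum bounded_bilinear.has_vector_derivative[OF bounded_bilinear_scaleR])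
  then show ?thesis
    by (simp add: sum.distrib linear_axis_expansion[OF linear_frame, symmetric]
        linear_axis_expansion[OF linear_frame_deriv2, symmetric])
qed

lemma frame_self [simp]: "frame p p = p"
  using frame_ray[of 1 p] by simp

text \<open>Differentiate the relation \<open>frame q q = q\<close> along a line through
  \<open>p\<close>.\<close>

lemma frame_deriv_self: "frame_deriv p u p = u - frame p u"
proof -
  have "((\<lambda>s. p + s *\<^sub>R u) has_vector_derivative u) (at 0)"
    by (auto intro!: derivative_eq_intros)
  from frame_product_rule[OF this this]
  have "((\<lambda>s. p + s *\<^sub>R u) has_vector_derivative frame_deriv p u p + frame p u) (at 0)" by simp
  moreover have "((\<lambda>s. p + s *\<^sub>R u) has_vector_derivative u) (at 0)"
    by (auto intro!: derivative_eq_intros)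
  ultimately have "frame_deriv p u p + frame p u = u" by (rule vector_derivative_unique_at)
  then show ?thesis by (simp add: algebra_simps)
qed

lemma matrix_frame: "matrix (frame p) *v Z = frame p Z"
  by (rule matrix_works) (simp add: linear_frame linear_matrix_vector_mul_eq)

lemma det_frame_nonzero: "det (matrix (frame p)) \<noteq> 0"
proof -
  have "inj (frame p)"
    using inj_frame linear_injective_0[OF linear_frame] by blast
  then show ?thesis using det_nz_iff_inj[OF linear_frame] by simp
qed

lemma frame_differentiable: "(\<lambda>q. matrix (frame q) $ i $ j) differentiable (at p)"
  unfolding matrix_def
  using bounded_linear.has_derivative[OF bounded_linear_vec_nth frame_has_derivative]
  by (auto simp: differentiable_def)

text \<open>
  The solution \<open>K t\<close> of \<open>frame (t X) (K t) = t Y\<close> is the left-trivialised differential of the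
  exponential map at \<open>t X\<close>, applied to \<open>t Y\<close>.
\<close>

lemma left_trivialised_exp:
  obtains K where "\<And>t. frame (t *\<^sub>R X) (K t) = t *\<^sub>R Y"
    "\<And>t. (K has_vector_derivative Y - lie_bracket \<Theta> X (K t)) (at t)"
proof -
  \<comment> \<open>Cramer's rule solves the defining relation by quotients of determinants, from
    which differentiability in \<open>t\<close> can be read off.\<close>
  define K :: "real \<Rightarrow> real ^ 'n" where
    "K t = (\<chi> k. det (\<chi> i j. if j = k then (t *\<^sub>R Y) $ i else matrix (frame (t *\<^sub>R X)) $ i $ j)
        / det (matrix (frame (t *\<^sub>R X))))" for t
  have K: "frame (t *\<^sub>R X) (K t) = t *\<^sub>R Y" for t
    using cramer[OF det_frame_nonzero, of "t *\<^sub>R X" "K t" "t *\<^sub>R Y"] by (simp add: matrix_frame K_def)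
  have fr: "(\<lambda>t. matrix (frame (t *\<^sub>R X)) $ i $ j) differentiable (at t)" for i j t
    using differentiable_chain_at[OF _ frame_differentiable, of "\<lambda>t. t *\<^sub>R X" t i j] by (simp add: o_def)
  have "(\<lambda>t. if j = k then (t *\<^sub>R Y) $ i else matrix (frame (t *\<^sub>R X)) $ i $ j) differentiable (at t)"
    for i j k t
    using fr by (cases "j = k") simp_all
  then have "(\<lambda>t. K t $ k) differentiable (at t)" for k t
    unfolding K_def vec_lambda_beta
    by (intro differentiable_divide differentiable_det det_frame_nonzero fr) simp
  then have Kd: "K differentiable (at t)" for t
    by (subst differentiable_componentwise_within) (auto simp: Basis_vec_def inner_axis)
  define K' where "K' t = vector_derivative K (at t)" for t
  have K': "(K has_vector_derivative K' t) (at t)" for t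
    using Kd unfolding K'_def by (rule vector_derivative_works[THEN iffD1])
  have "K' t = Y - lie_bracket \<Theta> X (K t)" for t
  proof -
    let ?p = "t *\<^sub>R X"
    have "((\<lambda>s. s *\<^sub>R X) has_vector_derivative X) (at t)" "((\<lambda>s. s *\<^sub>R Y) has_vector_derivative Y) (at t)"
      by (auto intro!: derivative_eq_intros)
    from frame_product_rule[OF this(1) K'] this(2)
    have 1: "frame_deriv ?p X (K t) + frame ?p (K' t) = Y"
      by (simp add: K vector_derivative_unique_at)
    \<comment> \<open>Bilinearity moves the factor \<open>t\<close> from the direction to the
      algebra element, which becomes the base point, so \<open>frame_deriv_self\<close> applies.
      Nothing is divided by \<open>t\<close>, and \<open>t = 0\<close> is covered.\<close>
    have "frame_deriv ?p (t *\<^sub>R Y) X = frame_deriv ?p Y ?p"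
      by (simp add: linear_scale[OF linear_frame_deriv1] linear_scale[OF linear_frame_deriv2])
    then have "frame ?p (lie_bracket \<Theta> X (K t)) = frame_deriv ?p X (K t) - (Y - frame ?p Y)"
      by (simp add: frame_lie_bracket frame_ray K frame_deriv_self)
    moreover have "frame ?p (K' t) = Y - frame_deriv ?p X (K t)"
      using 1 by (simp add: eq_diff_eq add.commute)
    ultimately have "frame ?p (K' t - (Y - lie_bracket \<Theta> X (K t))) = 0"
      by (simp only: linear_diff[OF linear_frame]) simp
    then show ?thesis using inj_frame by fastforce
  qed
  then show ?thesis using that[OF K] K' by simp
qed

section \<open>The frame under dilations and its determinant\<close>

lemma diagonalisable_A: "diagonalisable_pos A"
  using hom by (simp add: homogeneous_group_def)

lemma lie_dilation_bracket:
  "r > 0 \<Longrightarrow> lie_dilation A r (lie_bracket \<Theta> X Y) = lie_bracket \<Theta> (lie_dilation A r X) (lie_dilation A r Y)"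
  using hom by (simp add: homogeneous_group_def)

text \<open>The infinitesimal form of dilations being group automorphisms. Dilating the solution
  \<open>K\<close> for the ray of \<open>p\<close> gives the solution \<open>L\<close> for the
  dilated ray, because dilations respect the bracket; the claim is read off at time
  \<open>1\<close>.\<close>

lemma frame_lie_dilation:
  assumes "r > 0"
  shows "frame (lie_dilation A r p) (lie_dilation A r W) = lie_dilation A r (frame p W)"
proof -
  let ?D = "lie_dilation A r"
  note lin = linear_lie_dilation[OF diagonalisable_A assms]
  let ?Y = "frame p W"
  obtain K where K: "\<And>t. frame (t *\<^sub>R p) (K t) = t *\<^sub>R ?Y"
    "\<And>t. (K has_vector_derivative ?Y - lie_bracket \<Theta> p (K t)) (at t)"
    by (rule left_trivialised_exp) (rule that)
  obtain L where L: "\<And>t. frame (t *\<^sub>R ?D p) (L t) = t *\<^sub>R ?D ?Y"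
    "\<And>t. (L has_vector_derivative ?D ?Y - lie_bracket \<Theta> (?D p) (L t)) (at t)"
    by (rule left_trivialised_exp) (rule that)
  \<comment> \<open>The inhomogeneous terms cancel in the difference. Both curves start at
    \<open>0\<close>, since the defining relation at time \<open>0\<close> sets the identity frame
    applied to them equal to \<open>0\<close>.\<close>
  have "?D (K 1) - L 1 = 0"
  proof (rule linear_ode_zero[OF linear_lie_bracket])
    show "((\<lambda>t. ?D (K t) - L t) has_vector_derivative - lie_bracket \<Theta> (?D p) (?D (K t) - L t)) (at t)" for t
      using has_vector_derivative_diff[OF bounded_linear.has_vector_derivative[OF
            linear_conv_bounded_linear[THEN iffD1, OF lin] K(2)[of t]] L(2)[of t]]
      by (simp add: linear_diff[OF lin] linear_diff[OF linear_lie_bracket] lie_dilation_bracket[OF assms])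
    have "K 0 = 0" "L 0 = 0" using K(1)[of 0] L(1)[of 0] by simp_all
    then show "?D (K 0) - L 0 = 0" by (simp add: linear_0[OF lin])
  qed simp
  \<comment> \<open>The right-hand side was chosen as \<open>frame p W\<close>, so injectivity of
    \<open>frame p\<close> identifies \<open>K 1\<close>.\<close>
  moreover have "K 1 - W = 0"
    using K(1)[of 1] by - (rule inj_frame[of p], simp add: linear_diff[OF linear_frame])
  ultimately show ?thesis using L(1)[of 1] by simp
qed

lemma det_frame: "det (matrix (frame p)) = 1"
proof -
  have "det (matrix (frame (lie_dilation A r p))) = det (matrix (frame p))" if "r > 0" for r
  proof -
    let ?D = "lie_dilation A r"
    note lin = linear_lie_dilation[OF diagonalisable_A that]
    have "frame (?D p) \<circ> ?D = ?D \<circ> frame p"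
      using frame_lie_dilation[OF that] by (simp add: fun_eq_iff)
    then have "matrix (frame (?D p)) ** matrix ?D = matrix ?D ** matrix (frame p)"
      by (simp add: matrix_compose[OF lin linear_frame, symmetric] matrix_compose[OF linear_frame lin, symmetric])
    then have "det (matrix (frame (?D p))) * det (matrix ?D) = det (matrix ?D) * det (matrix (frame p))"
      by (metis det_mul)
    moreover have "det (matrix ?D) \<noteq> 0"
      using det_lie_dilation[OF diagonalisable_A that] that by simp
    ultimately show ?thesis by simp
  qed
  then have ev: "\<forall>\<^sub>F r in at_right 0. det (matrix (frame (lie_dilation A r p))) = det (matrix (frame p))"
    by (auto simp: eventually_at_filter)
  have "isCont (\<lambda>q. det (matrix (frame q))) 0"
    by (intro differentiable_imp_continuous_within differentiable_det frame_differentiable)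
  then have "((\<lambda>r. det (matrix (frame (lie_dilation A r p)))) \<longlongrightarrow> det (matrix (frame 0))) (at_right 0)"
    by (rule isCont_tendsto_compose) (rule lie_dilation_tendsto_zero[OF diagonalisable_A])
  moreover have "matrix (frame 0) = mat 1"
    by (simp add: matrix_def mat_def vec_eq_iff axis_def)
  ultimately have "((\<lambda>r. det (matrix (frame (lie_dilation A r p)))) \<longlongrightarrow> 1) (at_right 0)" by simp
  moreover have "((\<lambda>r. det (matrix (frame (lie_dilation A r p)))) \<longlongrightarrow> det (matrix (frame p))) (at_right 0)"
    using tendsto_eventually[OF ev] .
  ultimately show ?thesis
    using tendsto_unique trivial_limit_at_right_real by blast
qed

text \<open>Left translation carries the frame at \<open>p\<close> to the frame at the product, and
  both have determinant \<open>1\<close>.\<close>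

lemma det_coord_mult: "det (matrix (frechet_derivative (coord_mult a) (at p))) = 1"
proof -
  have "frechet_derivative (coord_mult a) (at p) \<circ> frame p = frame (coord_mult a p)"
    using frame_coord_mult by (simp add: fun_eq_iff)
  then have "matrix (frechet_derivative (coord_mult a) (at p)) ** matrix (frame p) = matrix (frame (coord_mult a p))"
    using matrix_compose[OF linear_frame has_derivative_linear[OF smooth_on_has_derivative[OF smooth_on_coord_mult]]]
    by metis
  then show ?thesis using det_frame by (metis det_mul mult.right_neutral)
qed

end


section \<open>Haar measure in exponential coordinates\<close>

lemma nn_integral_lborel_uminus:
  fixes f :: "'a::euclidean_space \<Rightarrow> ennreal"
  assumes [measurable]: "f \<in> borel_measurable borel"
  shows "(\<integral>\<^sup>+x. f (- x) \<partial>lborel) = (\<integral>\<^sup>+x. f x \<partial>lborel)"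
proof -
  have "distr lborel borel uminus = (lborel :: 'a measure)"
    using lborel_affine[of "- 1 :: real" "0 :: 'a"] by (simp add: density_1 flip: one_ennreal_def)
  then show ?thesis using nn_integral_distr[of uminus lborel borel f] by simp
qed

lemma sigma_finite_measure_compact:
  fixes \<mu> :: "'a::euclidean_space measure"
  assumes "sets \<mu> = sets borel" "\<And>K. compact K \<Longrightarrow> emeasure \<mu> K < \<infinity>"
  shows "sigma_finite_measure \<mu>"
proof
  show "\<exists>A. countable A \<and> A \<subseteq> sets \<mu> \<and> \<Union> A = space \<mu> \<and> (\<forall>a\<in>A. emeasure \<mu> a \<noteq> \<infinity>)"
  proof (intro exI[of _ "range (\<lambda>n::nat. cball 0 (real n))"] conjI ballI)
    have "space \<mu> = UNIV" using sets_eq_imp_space_eq[OF assms(1)] by simp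
    moreover have "x \<in> \<Union> (range (\<lambda>n::nat. cball 0 (real n)))" for x :: 'a
      using real_arch_simple[of "norm x"] by auto
    ultimately show "\<Union> (range (\<lambda>n::nat. cball 0 (real n))) = space \<mu>" by auto
  next
    fix a assume "a \<in> range (\<lambda>n::nat. cball (0 :: 'a) (real n))"
    then show "emeasure \<mu> a \<noteq> \<infinity>" using assms(2)[of a] by auto
  next
    show "range (\<lambda>n::nat. cball (0 :: 'a) (real n)) \<subseteq> sets \<mu>"
      by (intro image_subsetI) (simp add: assms(1))
  qed simp
qed

context homogeneous_lie_group
begin

section \<open>Left and right invariance of Lebesgue measure\<close>

lemma E_coord_mult [simp]: "E (coord_mult p q) = E p + E q"
  by (simp add: coord_mult_def)

lemma coord_mult_cancel [simp]: "coord_mult (- p) (coord_mult p q) = q" "coord_mult p (coord_mult (- p) q) = q"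
  by (simp_all add: coord_mult_def E_uminus add.assoc[symmetric])

text \<open>Inversion reverses products and is negation in exponential coordinates; this turns right
  translations into left ones.\<close>

lemma uminus_coord_mult: "coord_mult p q = - coord_mult (- q) (- p)"
proof -
  have "E (- coord_mult (- q) (- p)) = E (coord_mult p q)"
    by (simp add: E_uminus minus_add)
  then show ?thesis by (metis lg_E)
qed

lemma continuous_on_coord_mult: "continuous_on UNIV (\<lambda>z. coord_mult (fst z) (snd z))"
proof -
  have "continuous_on UNIV (\<lambda>(x, y). x + y :: 'g)"
    using hom by (simp add: homogeneous_group_def lie_group_def smooth_map_def)
  moreover have "continuous_on UNIV (\<lambda>z. (E (fst z), E (snd z)))"
    by (intro continuous_on_Pair continuous_on_compose2[OF continuous_on_E[of UNIV]] continuous_intros) auto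
  ultimately have "continuous_on UNIV (\<lambda>z. case (E (fst z), E (snd z)) of (x, y) \<Rightarrow> x + y)"
    by (rule continuous_on_compose2) auto
  then have "continuous_on UNIV (\<lambda>z. E (fst z) + E (snd z))" by simp
  then show ?thesis
    unfolding coord_mult_def by (rule continuous_on_compose2[OF continuous_on_lg[of UNIV]]) auto
qed

lemma coord_mult_measurable [measurable]: "(\<lambda>z. coord_mult (fst z) (snd z)) \<in> borel_measurable borel"
  using continuous_on_coord_mult by (rule borel_measurable_continuous_onI)

lemma coord_mult_measurable2 [measurable (raw)]:
  assumes "f \<in> borel_measurable M" "g \<in> borel_measurable M"
  shows "(\<lambda>x. coord_mult (f x) (g x)) \<in> borel_measurable M"
proof -
  have "(\<lambda>x. (f x, g x)) \<in> M \<rightarrow>\<^sub>M borel"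
    using assms by (simp add: borel_prod[symmetric])
  from measurable_compose[OF this coord_mult_measurable] show ?thesis by simp
qed

lemma coord_mult_image: "coord_mult a ` S = coord_mult (- a) -` S"
  by (rule vimage_eq_image_inverse[symmetric]) simp_all

lemma emeasure_lborel_coord_mult:
  assumes "S \<in> sets borel" shows "emeasure lborel (coord_mult a -` S) = emeasure lborel S"
proof -
  have "coord_mult (- a) ` S = coord_mult a -` S" using coord_mult_image[of "- a"] by simp
  moreover have "coord_mult a -` S \<in> sets borel"
    using assms measurable_sets_borel[of "coord_mult a" borel] by measurable
  ultimately show ?thesis
    using emeasure_lborel_image[of "coord_mult (- a)" "\<lambda>x. frechet_derivative (coord_mult (- a)) (at x)" 1 S]
      smooth_on_has_derivative[OF smooth_on_coord_mult] det_coord_mult assms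
    by (metis abs_one coord_mult_cancel(2) ennreal_1 injI mult_1 zero_less_one)
qed

lemma nn_integral_lborel_coord_mult:
  assumes [measurable]: "f \<in> borel_measurable borel"
  shows "(\<integral>\<^sup>+x. f (coord_mult a x) \<partial>lborel) = (\<integral>\<^sup>+x. f x \<partial>lborel)"
proof -
  have "distr lborel borel (coord_mult a) = lborel"
    by (intro measure_eqI) (simp_all add: emeasure_distr emeasure_lborel_coord_mult)
  then show ?thesis
    using nn_integral_distr[of "coord_mult a" lborel borel f] by simp
qed

text \<open>A right translation is a left translation conjugated with
  \<open>p \<mapsto> - p\<close>, and Lebesgue measure is invariant under both.\<close>

lemma nn_integral_lborel_coord_mult_right:
  assumes [measurable]: "f \<in> borel_measurable borel"
  shows "(\<integral>\<^sup>+x. f (coord_mult x a) \<partial>lborel) = (\<integral>\<^sup>+x. f x \<partial>lborel)"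
proof -
  have "(\<integral>\<^sup>+x. f (coord_mult x a) \<partial>lborel) = (\<integral>\<^sup>+x. f (- coord_mult (- a) (- x)) \<partial>lborel)"
    by (subst uminus_coord_mult) simp
  also have "\<dots> = (\<integral>\<^sup>+x. f (- coord_mult (- a) x) \<partial>lborel)"
    by (rule nn_integral_lborel_uminus[of "\<lambda>x. f (- coord_mult (- a) x)"]) measurable
  also have "\<dots> = (\<integral>\<^sup>+x. f (- x) \<partial>lborel)"
    by (rule nn_integral_lborel_coord_mult[of "\<lambda>x. f (- x)"]) measurable
  also have "\<dots> = (\<integral>\<^sup>+x. f x \<partial>lborel)"
    by (rule nn_integral_lborel_uminus) measurable
  finally show ?thesis .
qed

text \<open>The classical uniqueness argument. Right invariance of Lebesgue measure inserts a
  translation of \<open>g\<close> by \<open>y\<close>; after Fubini, left invariance of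
  \<open>\<nu>\<close> shifts it to \<open>f\<close>; Fubini, \<open>y \<mapsto> - y\<close> and
  right invariance then remove it. The cross-multiplied form remains meaningful for infinite
  integrals.\<close>

lemma left_invariant_proportional:
  fixes \<nu> :: "(real ^ 'n) measure"
  assumes [measurable_cong]: "sets \<nu> = sets borel" and "sigma_finite_measure \<nu>"
    and inv: "\<And>a f. f \<in> borel_measurable borel \<Longrightarrow> (\<integral>\<^sup>+x. f (coord_mult a x) \<partial>\<nu>) = (\<integral>\<^sup>+x. f x \<partial>\<nu>)"
    and [measurable]: "f \<in> borel_measurable borel" "g \<in> borel_measurable borel"
  shows "(\<integral>\<^sup>+x. f x \<partial>\<nu>) * (\<integral>\<^sup>+x. g x \<partial>lborel) = (\<integral>\<^sup>+x. g x \<partial>\<nu>) * (\<integral>\<^sup>+x. f x \<partial>lborel)"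
proof -
  interpret \<nu>: sigma_finite_measure \<nu> by fact
  interpret pair_sigma_finite \<nu> "lborel :: (real ^ 'n) measure" ..
  have "(\<integral>\<^sup>+x. f x \<partial>\<nu>) * (\<integral>\<^sup>+x. g x \<partial>lborel) = (\<integral>\<^sup>+x. f x * (\<integral>\<^sup>+y. g (coord_mult y x) \<partial>lborel) \<partial>\<nu>)"
    by (simp add: nn_integral_lborel_coord_mult_right nn_integral_multc)
  also have "\<dots> = (\<integral>\<^sup>+x. (\<integral>\<^sup>+y. f x * g (coord_mult y x) \<partial>lborel) \<partial>\<nu>)"
    by (intro nn_integral_cong) (simp add: nn_integral_cmult)
  also have "\<dots> = (\<integral>\<^sup>+y. (\<integral>\<^sup>+x. f x * g (coord_mult y x) \<partial>\<nu>) \<partial>lborel)"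
    by (rule Fubini'[symmetric]) measurable
  also have "\<dots> = (\<integral>\<^sup>+y. (\<integral>\<^sup>+x. f (coord_mult (- y) x) * g x \<partial>\<nu>) \<partial>lborel)"
  proof (rule nn_integral_cong)
    fix y
    show "(\<integral>\<^sup>+x. f x * g (coord_mult y x) \<partial>\<nu>) = (\<integral>\<^sup>+x. f (coord_mult (- y) x) * g x \<partial>\<nu>)"
      using inv[of "\<lambda>x. f (coord_mult (- y) x) * g x" y] by simp
  qed
  also have "\<dots> = (\<integral>\<^sup>+x. (\<integral>\<^sup>+y. f (coord_mult (- y) x) * g x \<partial>lborel) \<partial>\<nu>)"
    by (rule Fubini') measurable
  also have "\<dots> = (\<integral>\<^sup>+x. (\<integral>\<^sup>+y. f (coord_mult (- y) x) \<partial>lborel) * g x \<partial>\<nu>)"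
    by (intro nn_integral_cong) (simp add: nn_integral_multc)
  also have "\<dots> = (\<integral>\<^sup>+x. (\<integral>\<^sup>+y. f y \<partial>lborel) * g x \<partial>\<nu>)"
  proof (rule nn_integral_cong)
    fix x
    have "(\<integral>\<^sup>+y. f (coord_mult (- y) x) \<partial>lborel) = (\<integral>\<^sup>+y. f (coord_mult y x) \<partial>lborel)"
      by (rule nn_integral_lborel_uminus[of "\<lambda>y. f (coord_mult y x)"]) measurable
    then show "(\<integral>\<^sup>+y. f (coord_mult (- y) x) \<partial>lborel) * g x = (\<integral>\<^sup>+y. f y \<partial>lborel) * g x"
      by (simp add: nn_integral_lborel_coord_mult_right)
  qed
  also have "\<dots> = (\<integral>\<^sup>+x. g x \<partial>\<nu>) * (\<integral>\<^sup>+x. f x \<partial>lborel)"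
    by (subst nn_integral_cmult) (simp_all add: mult.commute)
  finally show ?thesis .
qed

section \<open>Haar measure in coordinates and its scaling\<close>

definition coord_measure :: "'g measure \<Rightarrow> (real ^ 'n) measure" where
  "coord_measure \<mu> = distr \<mu> borel lg"

lemma sets_coord_measure [measurable_cong, simp]: "sets (coord_measure \<mu>) = sets borel"
  by (simp add: coord_measure_def)

context
  fixes \<mu> :: "'g measure"
  assumes haar: "haar_measure \<mu>"
begin

lemma sets_haar [measurable_cong]: "sets \<mu> = sets borel"
  using haar by (simp add: haar_measure_def)

lemma lg_measurable: "lg \<in> \<mu> \<rightarrow>\<^sub>M borel"
  using borel_measurable_continuous_onI[OF continuous_on_lg] measurable_cong_sets[OF sets_haar refl] by blast

lemma emeasure_coord_measure:
  assumes "S \<in> sets borel" shows "emeasure (coord_measure \<mu>) S = emeasure \<mu> (E ` S)"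
proof -
  have "space \<mu> = UNIV" using sets_eq_imp_space_eq[OF sets_haar] by simp
  moreover have "lg -` S = E ` S" by (rule vimage_eq_image_inverse) simp_all
  ultimately show ?thesis
    using assms by (simp add: coord_measure_def emeasure_distr[OF lg_measurable])
qed

lemma coord_measure_finite:
  assumes "compact K" shows "emeasure (coord_measure \<mu>) K < \<infinity>"
  using assms haar compact_continuous_image[OF continuous_on_E assms]
  by (simp add: emeasure_coord_measure borel_compact haar_measure_def)

lemma sigma_finite_coord_measure: "sigma_finite_measure (coord_measure \<mu>)"
  by (intro sigma_finite_measure_compact coord_measure_finite) simp

lemma coord_measure_invariant:
  assumes [measurable]: "f \<in> borel_measurable borel"
  shows "(\<integral>\<^sup>+x. f (coord_mult a x) \<partial>coord_measure \<mu>) = (\<integral>\<^sup>+x. f x \<partial>coord_measure \<mu>)"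
proof -
  have "emeasure (coord_measure \<mu>) (coord_mult a -` S) = emeasure (coord_measure \<mu>) S"
    if S: "S \<in> sets borel" for S
  proof -
    have "coord_mult a -` S \<in> sets borel"
      using S measurable_sets_borel[of "coord_mult a" borel] by measurable
    moreover have "E ` (coord_mult a -` S) = (\<lambda>x. - E a + x) ` E ` S"
    proof -
      have "coord_mult a -` S = coord_mult (- a) ` S" using coord_mult_image[of "- a"] by simp
      then show ?thesis by (simp add: image_image E_uminus)
    qed
    moreover have "E ` S \<in> sets borel"
    proof -
      have "lg -` S = E ` S" by (rule vimage_eq_image_inverse) simp_all
      then show ?thesis
        using measurable_sets_borel[OF borel_measurable_continuous_onI[OF continuous_on_lg] S] by simp
    qed
    ultimately show ?thesis
      using haar S by (simp add: emeasure_coord_measure haar_measure_def)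
  qed
  then have "distr (coord_measure \<mu>) borel (coord_mult a) = coord_measure \<mu>"
    by (intro measure_eqI) (simp_all add: emeasure_distr sets_eq_imp_space_eq[OF sets_coord_measure])
  then show ?thesis
    using nn_integral_distr[of "coord_mult a" "coord_measure \<mu>" borel f] by simp
qed

text \<open>The constant is the measure of the unit cube, a test set of Lebesgue measure
  \<open>1\<close>.\<close>

lemma coord_measure_lebesgue:
  obtains c :: ennreal where "\<And>S. S \<in> sets borel \<Longrightarrow> emeasure (coord_measure \<mu>) S = c * emeasure lborel S"
proof -
  let ?B = "cbox 0 One :: (real ^ 'n) set"
  have "emeasure lborel ?B = 1" by (subst emeasure_lborel_cbox) auto
  then have "emeasure (coord_measure \<mu>) S = emeasure (coord_measure \<mu>) ?B * emeasure lborel S"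
    if "S \<in> sets borel" for S
    using left_invariant_proportional[OF sets_coord_measure sigma_finite_coord_measure
        coord_measure_invariant, of "indicator S" "indicator ?B"] that
    by simp
  then show ?thesis by (rule that)
qed

text \<open>The push-forward measures preimages under the dilation by \<open>r\<close>, which are
  images under the dilation by \<open>1 / r\<close>; hence the negative exponent.\<close>

lemma distr_coord_measure_dilation:
  assumes "r > 0"
  shows "distr (coord_measure \<mu>) borel (lie_dilation A r)
       = density (coord_measure \<mu>) (\<lambda>_. ennreal (r powr - homogeneous_dimension A))"
proof (rule measure_eqI)
  let ?D = "lie_dilation A"
  obtain c where c: "\<And>S. S \<in> sets borel \<Longrightarrow> emeasure (coord_measure \<mu>) S = c * emeasure lborel S"
    by (rule coord_measure_lebesgue) (rule that)
  have inv: "?D r (?D (1 / r) x) = x" "?D (1 / r) (?D r x) = x" for x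
    using assms by (simp_all add: lie_dilation_mult[OF diagonalisable_A] lie_dilation_one[OF diagonalisable_A])
  have lin: "linear (?D s)" if "s > 0" for s using linear_lie_dilation[OF diagonalisable_A that] .
  have meas: "?D r \<in> borel_measurable borel"
    by (intro borel_measurable_continuous_onI linear_continuous_on linear_conv_bounded_linear[THEN iffD1] lin assms)
  fix S assume "S \<in> sets (distr (coord_measure \<mu>) borel (?D r))"
  then have S: "S \<in> sets borel" by simp
  have vim: "?D r -` S = ?D (1 / r) ` S" by (rule vimage_eq_image_inverse) (simp_all add: inv)
  have vS: "?D r -` S \<in> sets borel" using measurable_sets_borel[OF meas S] .
  have "emeasure lborel (?D (1 / r) ` S) = ennreal ((1 / r) powr homogeneous_dimension A) * emeasure lborel S"
  proof (rule emeasure_lborel_image)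
    show "(?D (1 / r) has_derivative ?D (1 / r)) (at x)" for x
      using lin[of "1 / r"] assms by (intro linear_imp_has_derivative) simp
    show "inj (?D (1 / r))" using inv(1) by (metis injI)
    show "\<bar>det (matrix (?D (1 / r)))\<bar> = (1 / r) powr homogeneous_dimension A"
      using assms by (simp add: det_lie_dilation[OF diagonalisable_A])
  qed (use assms S vS vim in auto)
  also have "(1 / r) powr homogeneous_dimension A = r powr - homogeneous_dimension A"
    using assms by (simp add: powr_minus powr_divide inverse_eq_divide)
  finally have "emeasure (coord_measure \<mu>) (?D r -` S)
      = ennreal (r powr - homogeneous_dimension A) * emeasure (coord_measure \<mu>) S"
    using S vS vim c by (simp add: mult_ac)
  then show "emeasure (distr (coord_measure \<mu>) borel (?D r)) S
      = emeasure (density (coord_measure \<mu>) (\<lambda>_. ennreal (r powr - homogeneous_dimension A))) S"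
    using S meas by (simp add: emeasure_distr sets_eq_imp_space_eq[OF sets_coord_measure]
        emeasure_density nn_integral_cmult)
qed simp

lemma integral_coord_measure_dilation:
  fixes h :: "real ^ 'n \<Rightarrow> real"
  assumes "r > 0" and [measurable]: "h \<in> borel_measurable borel"
  shows "(LINT x|coord_measure \<mu>. h (lie_dilation A r x))
       = r powr - homogeneous_dimension A * (LINT x|coord_measure \<mu>. h x)"
proof -
  have meas: "lie_dilation A r \<in> borel_measurable borel"
    using assms(1) linear_lie_dilation[OF diagonalisable_A]
    by (intro borel_measurable_continuous_onI linear_continuous_on linear_conv_bounded_linear[THEN iffD1]) auto
  have "(LINT x|coord_measure \<mu>. h (lie_dilation A r x)) = (LINT x|distr (coord_measure \<mu>) borel (lie_dilation A r). h x)"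
    using meas by (subst integral_distr) simp_all
  also have "\<dots> = (LINT x|coord_measure \<mu>. r powr - homogeneous_dimension A * h x)"
    unfolding distr_coord_measure_dilation[OF assms(1)] by (subst integral_density) simp_all
  finally show ?thesis by simp
qed

lemma integral_haar:
  fixes \<phi> :: "'g \<Rightarrow> real"
  assumes "(\<lambda>p. \<phi> (E p)) \<in> borel_measurable borel"
  shows "(LINT x|\<mu>. \<phi> x) = (LINT p|coord_measure \<mu>. \<phi> (E p))"
  unfolding coord_measure_def using integral_distr[OF lg_measurable assms] by simp

end

end


section \<open>Euler operator and radial integration by parts\<close>

text \<open>Dominated convergence works with sequences, so the derivative is approached along the
  steps \<open>1 / (m + 1)\<close>.\<close>

lemma difference_quotient_sequence:
  fixes g :: "real \<Rightarrow> real"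
  assumes "(g has_real_derivative D) (at x)"
  shows "(\<lambda>m. (g (x + inverse (real (Suc m))) - g x) * real (Suc m)) \<longlonglongrightarrow> D"
proof -
  have "((\<lambda>h. (g (x + h) - g x) / h) \<longlongrightarrow> D) (at 0)"
    using assms by (simp add: DERIV_def)
  moreover have "filterlim (\<lambda>m. inverse (real (Suc m))) (at 0) sequentially"
    using LIMSEQ_inverse_real_of_nat by (auto simp: filterlim_at)
  ultimately have "(\<lambda>m. (g (x + inverse (real (Suc m))) - g x) / inverse (real (Suc m))) \<longlonglongrightarrow> D"
    by (rule filterlim_compose)
  then show ?thesis by (simp add: divide_inverse)
qed

text \<open>The derivative along the linear vector field \<open>A\<close>, the generator of the
  dilations; for \<open>A\<close> the identity this is the classical Euler operator.\<close>

definition euler :: "('a \<Rightarrow> 'a) \<Rightarrow> ('a::real_normed_vector \<Rightarrow> 'b::real_normed_vector) \<Rightarrow> 'a \<Rightarrow> 'b" where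
  "euler A G p = frechet_derivative G (at p) (A p)"

lemma smooth_on_euler:
  fixes G :: "'a::euclidean_space \<Rightarrow> 'b::real_normed_vector"
  assumes "linear A" "smooth_on UNIV G"
  shows "smooth_on UNIV (euler A G)"
  unfolding smooth_on_def
proof
  fix k
  have G: "Ck_on (Suc k) UNIV G" using assms(2) by (simp add: smooth_on_def del: Ck_on.simps)
  have "euler A G p = (\<Sum>b\<in>Basis. (A p \<bullet> b) *\<^sub>R frechet_derivative G (at p) b)" for p
  proof -
    interpret linear "frechet_derivative G (at p)"
      using has_derivative_linear[OF Ck_on_Suc_has_derivative[OF G]] by simp
    have "frechet_derivative G (at p) (\<Sum>b\<in>Basis. (A p \<bullet> b) *\<^sub>R b)
        = (\<Sum>b\<in>Basis. (A p \<bullet> b) *\<^sub>R frechet_derivative G (at p) b)"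
      by (simp add: sum scale)
    then show ?thesis by (simp add: euler_def euclidean_representation)
  qed
  moreover have "Ck_on k UNIV (\<lambda>p. \<Sum>b\<in>Basis. (A p \<bullet> b) *\<^sub>R frechet_derivative G (at p) b)"
  proof (intro Ck_on_sum open_UNIV Ck_on_bilinear[OF _ bounded_bilinear_scaleR])
    show "Ck_on k UNIV (\<lambda>p. A p \<bullet> b)" for b
      using Ck_on_linear_compose[OF open_UNIV bounded_linear_inner_left
          Ck_on_bounded_linear[OF open_UNIV linear_conv_bounded_linear[THEN iffD1, OF assms(1)]]] .
    show "Ck_on k UNIV (\<lambda>p. frechet_derivative G (at p) b)" for b
      using G by simp
  qed
  ultimately show "Ck_on k UNIV (euler A G)" by presburger
qed

lemma euler_eq_0:
  assumes "closed K" "\<And>q. q \<notin> K \<Longrightarrow> G q = 0" "p \<notin> K"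
  shows "euler A G p = 0"
proof -
  have "(G has_derivative (\<lambda>_. 0)) (at p)"
    by (rule has_derivative_transform_within_open[OF has_derivative_const[of 0] open_Compl[OF assms(1)]])
      (use assms in auto)
  then show ?thesis
    unfolding euler_def using frechet_derivative_at by metis
qed

lemma smooth_on_continuous: "smooth_on UNIV G \<Longrightarrow> continuous_on UNIV G"
  unfolding smooth_on_def by (metis Ck_on.simps(1))

context homogeneous_lie_group
begin

lemma linear_A: "linear A"
  using diagonalisable_A by (simp add: diagonalisable_pos_def)

lemma dilation_has_vector_derivative:
  assumes "smooth_on UNIV G" "r > 0"
  shows "((\<lambda>r. G (lie_dilation A r q)) has_vector_derivative
           (1 / r) *\<^sub>R euler A G (lie_dilation A r q)) (at r)"
proof -
  note G = smooth_on_has_derivative[OF assms(1), of "lie_dilation A r q"]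
  have "((\<lambda>r. G (lie_dilation A r q)) has_vector_derivative
      frechet_derivative G (at (lie_dilation A r q)) ((1 / r) *\<^sub>R A (lie_dilation A r q))) (at r)"
    by (rule has_vector_derivative_compose[OF lie_dilation_has_vector_derivative[OF diagonalisable_A assms(2)] G refl])
  then show ?thesis
    by (simp add: euler_def linear_scale[OF has_derivative_linear[OF G]])
qed

lemma lie_dilation_inverse:
  assumes "r > 0"
  shows "lie_dilation A r (lie_dilation A (1 / r) p) = p" "lie_dilation A (1 / r) (lie_dilation A r p) = p"
  using assms by (simp_all add: lie_dilation_mult[OF diagonalisable_A] lie_dilation_one[OF diagonalisable_A])

context
  fixes N :: "'g \<Rightarrow> real"
  assumes N: "homogeneous_quasi_norm (group_dilation E A) N"
begin

section \<open>Radial derivatives of quotients by powers of the quasi-norm\<close>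

lemma N_nonneg: "N x \<ge> 0" and N_eq_0: "N x = 0 \<longleftrightarrow> x = 0"
  using N by (auto simp: homogeneous_quasi_norm_def)

lemma N_dilation:
  assumes "r > 0" shows "N (E (lie_dilation A r p)) = r * N (E p)"
proof -
  have "N (group_dilation E A r (E p)) = r * N (E p)"
    using N assms by (simp add: homogeneous_quasi_norm_def)
  then show ?thesis by (simp add: group_dilation_def)
qed

lemma continuous_on_N: "continuous_on S (\<lambda>p. N (E p))"
  using N by (intro continuous_on_compose2[OF _ continuous_on_E, of UNIV]) (auto simp: homogeneous_quasi_norm_def)

lemma N_E_eq_0: "N (E p) = 0 \<longleftrightarrow> p = 0"
  using N_eq_0[of "E p"] by (metis E_0 lg_0 lg_E)

text \<open>On the orbit of a point of the unit sphere \<open>N\<close> equals the parameter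
  \<open>r\<close>, so only \<open>r \<mapsto> (1 / r) ^ k\<close> and a smooth function along the
  orbit are differentiated. The result has the same form with exponent \<open>Suc k\<close>, so the
  lemma can be iterated.\<close>

lemma radial_derivative_eq:
  assumes G: "smooth_on UNIV G"
    and g: "\<And>p. p \<noteq> 0 \<Longrightarrow> g (E p) = (1 / N (E p)) ^ k *\<^sub>R G p"
  shows "radial_derivative (group_dilation E A) N g x
       = (1 / N x) ^ Suc k *\<^sub>R (euler A G (lg x) - real k *\<^sub>R G (lg x))"
proof (cases "x = 0")
  \<comment> \<open>At the identity both sides are \<open>0\<close>: the orbit is constant, and
    \<open>1 / N x\<close> is \<open>1 / 0 = 0\<close>.\<close>
  case True
  then show ?thesis
    by (simp add: radial_derivative_def group_dilation_def lie_dilation_zero[OF diagonalisable_A] N_eq_0)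
next
  case False
  let ?D = "lie_dilation A" and ?\<rho> = "N x"
  have \<rho>: "?\<rho> > 0" using False N_nonneg[of x] N_eq_0[of x] by linarith
  define q where "q = ?D (1 / ?\<rho>) (lg x)"
  have q: "?D ?\<rho> q = lg x" using lie_dilation_inverse[OF \<rho>] by (simp add: q_def)
  have Nq: "N (E (?D r q)) = r" if "r > 0" for r
    using that \<rho> N_dilation[of r] N_dilation[of "1 / ?\<rho>"] by (simp add: q_def)
  have "((\<lambda>r. (1 / r) ^ k *\<^sub>R G (?D r q)) has_vector_derivative
      (1 / ?\<rho>) ^ k *\<^sub>R ((1 / ?\<rho>) *\<^sub>R euler A G (lg x)) + (- (real k * (1 / ?\<rho>) ^ Suc k)) *\<^sub>R G (lg x)) (at ?\<rho>)"
  proof -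
    have "((\<lambda>r. (1 / r) ^ k) has_real_derivative - (real k * (1 / ?\<rho>) ^ Suc k)) (at ?\<rho>)"
    proof -
      have "((\<lambda>r. 1 / r) has_real_derivative - ((1 / ?\<rho>) * (1 / ?\<rho>))) (at ?\<rho>)"
        using \<rho> by (auto intro!: derivative_eq_intros)
      from DERIV_power[OF this, of k] show ?thesis
        by (cases k) (simp_all add: mult_ac)
    qed
    from has_vector_derivative_scaleR[OF this dilation_has_vector_derivative[OF G \<rho>, of q]]
    show ?thesis by (simp add: q)
  qed
  also have "(1 / ?\<rho>) ^ k *\<^sub>R ((1 / ?\<rho>) *\<^sub>R euler A G (lg x)) + (- (real k * (1 / ?\<rho>) ^ Suc k)) *\<^sub>R G (lg x)
      = (1 / ?\<rho>) ^ Suc k *\<^sub>R (euler A G (lg x) - real k *\<^sub>R G (lg x))"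
    by (simp add: scaleR_diff_right mult_ac)
  finally have "((\<lambda>r. g (E (?D r q))) has_vector_derivative
      (1 / ?\<rho>) ^ Suc k *\<^sub>R (euler A G (lg x) - real k *\<^sub>R G (lg x))) (at ?\<rho>)"
  proof (rule has_vector_derivative_transform_within_open[of _ _ _ "{0<..}"])
    fix r :: real assume "r \<in> {0<..}"
    then have "N (E (?D r q)) = r" "r > 0" using Nq by auto
    then show "(1 / r) ^ k *\<^sub>R G (?D r q) = g (E (?D r q))"
      using g[of "?D r q"] N_E_eq_0[of "?D r q"] by simp
  qed (use \<rho> in auto)
  then show ?thesis
    unfolding radial_derivative_def group_dilation_def by (simp add: q_def vector_derivative_at)
qed

lemma N_measurable [measurable]: "(\<lambda>p. N (E p)) \<in> borel_measurable borel"
  by (rule borel_measurable_continuous_onI[OF continuous_on_N])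

lemma bounded_inverse_N:
  assumes "compact K" "0 \<notin> K"
  obtains B where "\<And>p. p \<in> K \<Longrightarrow> 1 / N (E p) ^ k \<le> B" "B \<ge> 0"
proof -
  have "continuous_on K (\<lambda>p. 1 / N (E p) ^ k)"
    using assms N_E_eq_0 by (intro continuous_intros continuous_on_N) auto
  then have "bounded ((\<lambda>p. 1 / N (E p) ^ k) ` K)"
    using assms(1) by (intro compact_imp_bounded compact_continuous_image)
  then obtain B where "\<And>p. p \<in> K \<Longrightarrow> \<bar>1 / N (E p) ^ k\<bar> \<le> B" "B > 0"
    unfolding bounded_pos by auto
  then show ?thesis by (intro that[of B]) (use N_nonneg in auto)
qed

context
  fixes \<mu> :: "'g measure"
  assumes haar: "haar_measure \<mu>"
begin

section \<open>Integration by parts along the dilations\<close>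

lemma integrable_const_indicator:
  assumes "compact K"
  shows "integrable (coord_measure \<mu>) (\<lambda>p. B * indicator K p :: real)"
  using coord_measure_finite[OF haar assms] assms
  by (intro integrable_mult_right integrable_real_indicator) (simp_all add: borel_compact)

text \<open>The support is compact and avoids the origin, so \<open>1 / N ^ k\<close> is bounded on
  it, and the measure is finite on compact sets.\<close>

lemma integrable_quotient:
  fixes P :: "real ^ 'n \<Rightarrow> real"
  assumes "compact K" "0 \<notin> K" "continuous_on UNIV P" "\<And>p. p \<notin> K \<Longrightarrow> P p = 0"
  shows "integrable (coord_measure \<mu>) (\<lambda>p. P p / N (E p) ^ k)"
proof -
  obtain B where B: "\<And>p. p \<in> K \<Longrightarrow> 1 / N (E p) ^ k \<le> B" "B \<ge> 0"
    using bounded_inverse_N[OF assms(1,2)] by blast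
  have "bounded (P ` K)"
    using assms(1,3) continuous_on_subset by (intro compact_imp_bounded compact_continuous_image) auto
  then obtain C where C: "\<And>p. p \<in> K \<Longrightarrow> \<bar>P p\<bar> \<le> C" "C > 0"
    unfolding bounded_pos by auto
  have [measurable]: "P \<in> borel_measurable borel"
    by (rule borel_measurable_continuous_onI[OF assms(3)])
  show ?thesis
  proof (rule Bochner_Integration.integrable_bound[OF integrable_const_indicator[OF assms(1)]])
    show "AE p in coord_measure \<mu>. norm (P p / N (E p) ^ k) \<le> norm (C * B * indicator K p)"
    proof (rule AE_I2)
      fix p
      show "norm (P p / N (E p) ^ k) \<le> norm (C * B * indicator K p)"
      proof (cases "p \<in> K")
        case True
        have "\<bar>P p\<bar> * (1 / N (E p) ^ k) \<le> C * B"
          using True B C N_nonneg[of "E p"] by (intro mult_mono) auto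
        then show ?thesis using True B C N_nonneg[of "E p"] by (simp add: abs_mult)
      qed (simp add: assms(4))
    qed
  qed measurable
qed

text \<open>
  Both sides of \<open>(LINT p. H (D r p) / N p ^ k) = r powr (k - Q) * (LINT p. H p / N p ^ k)\<close>
  are differentiated at \<open>r = 1\<close>.
\<close>

lemma integral_radial_divergence:
  fixes H H' :: "real ^ 'n \<Rightarrow> real"
  assumes K: "compact K" "0 \<notin> K"
    and H: "continuous_on UNIV H" "\<And>p. p \<notin> K \<Longrightarrow> H p = 0"
    and H': "continuous_on UNIV H'" "\<And>p. p \<notin> K \<Longrightarrow> H' p = 0"
    and deriv: "\<And>r p. r > 0 \<Longrightarrow>
      ((\<lambda>r. H (lie_dilation A r p)) has_real_derivative H' (lie_dilation A r p) / r) (at r)"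
  shows "(LINT p|coord_measure \<mu>. (H' p + (homogeneous_dimension A - real k) * H p) / N (E p) ^ k) = 0"
proof -
  let ?D = "lie_dilation A" and ?Q = "homogeneous_dimension A" and ?M = "coord_measure \<mu>"
  define I where "I = (LINT p|?M. H p / N (E p) ^ k)"
  define \<rho> where "\<rho> m = 1 + inverse (real (Suc m))" for m
  have \<rho>: "\<rho> m > 1" "\<rho> m \<le> 2" for m
    by (auto simp: \<rho>_def field_simps)
  have [measurable]: "H \<in> borel_measurable borel" "H' \<in> borel_measurable borel"
    using H(1) H'(1) by (auto intro: borel_measurable_continuous_onI)
  have D_meas: "?D r \<in> borel_measurable borel" if "r > 0" for r
    using linear_lie_dilation[OF diagonalisable_A that]
    by (intro borel_measurable_continuous_onI linear_continuous_on linear_conv_bounded_linear[THEN iffD1])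
  have HD_meas: "(\<lambda>p. H (?D (\<rho> m) p)) \<in> borel_measurable borel" for m
  proof -
    have "?D (\<rho> m) \<in> borel_measurable borel" using D_meas[of "\<rho> m"] \<rho>(1)[of m] by simp
    then show ?thesis by measurable
  qed
  have int: "integrable ?M (\<lambda>p. H p / N (E p) ^ k)" "integrable ?M (\<lambda>p. H' p / N (E p) ^ k)"
    by (intro integrable_quotient[OF K] H H'; simp)+
  \<comment> \<open>One compact set that contains the supports of all \<open>H (D r p)\<close> with
    \<open>1 \<le> r \<le> 2\<close>: such supports are dilates of \<open>K\<close> by
    \<open>1 / r\<close>. It carries the dominating function and still avoids the origin.\<close>
  define L where "L = (\<lambda>(r, p). ?D r p) ` ({1 / 2..1} \<times> K)"
  have "continuous_on ({1 / 2..1} \<times> K) (\<lambda>(r, p). ?D r p)"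
    by (rule continuous_on_subset[OF continuous_on_lie_dilation[OF diagonalisable_A]]) auto
  then have L: "compact L"
    unfolding L_def using K(1) by (intro compact_continuous_image compact_Times) auto
  have "?D r p \<noteq> 0" if "r > 0" "p \<in> K" for r p
    using that K(2) lie_dilation_inverse(2)[OF that(1), of p] lie_dilation_zero[OF diagonalisable_A, of "1 / r"]
    by metis
  then have L0: "0 \<notin> L" by (force simp: L_def)
  have notL: "?D r p \<notin> K" if "p \<notin> L" "1 \<le> r" "r \<le> 2" for r p
  proof
    assume "?D r p \<in> K"
    moreover have "p = ?D (1 / r) (?D r p)" using that by (simp add: lie_dilation_inverse)
    moreover have "1 / r \<in> {1 / 2..1}" using that by (auto simp: field_simps)
    ultimately have "p \<in> L" unfolding L_def by (intro image_eqI[of _ _ "(1 / r, ?D r p)"]) auto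
    then show False using that by simp
  qed
  obtain B where B: "\<And>p. p \<in> L \<Longrightarrow> 1 / N (E p) ^ k \<le> B" "B \<ge> 0"
    using bounded_inverse_N[OF L L0] by blast
  have "bounded (H' ` K)"
    using K(1) H'(1) continuous_on_subset by (intro compact_imp_bounded compact_continuous_image) auto
  then obtain C where C0: "\<And>p. p \<in> K \<Longrightarrow> \<bar>H' p\<bar> \<le> C" "C > 0"
    unfolding bounded_pos by auto
  have C: "\<bar>H' p\<bar> \<le> C" for p
    using C0 H'(2) by (cases "p \<in> K") auto
  define s where "s m p = (H (?D (\<rho> m) p) - H p) * real (Suc m) / N (E p) ^ k" for m p
  \<comment> \<open>By the mean value theorem in \<open>r\<close> the difference quotient is
    \<open>H'\<close> at an intermediate dilate divided by \<open>\<xi>\<close>, and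
    \<open>\<xi> > 1\<close> only makes it smaller.\<close>
  have bound: "\<bar>H (?D (\<rho> m) p) - H p\<bar> * real (Suc m) \<le> C" for m p
  proof -
    have "\<exists>\<xi>>1. \<xi> < \<rho> m \<and> H (?D (\<rho> m) p) - H (?D 1 p) = (\<rho> m - 1) * (H' (?D \<xi> p) / \<xi>)"
      using deriv \<rho>(1)[of m] by (intro MVT2) auto
    then obtain \<xi> where \<xi>: "\<xi> > 1" "H (?D (\<rho> m) p) - H p = (\<rho> m - 1) * (H' (?D \<xi> p) / \<xi>)"
      by (auto simp: lie_dilation_one[OF diagonalisable_A])
    have "(\<rho> m - 1) * real (Suc m) = 1" by (simp add: \<rho>_def)
    then have "\<bar>H (?D (\<rho> m) p) - H p\<bar> * real (Suc m) = \<bar>H' (?D \<xi> p)\<bar> / \<xi>"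
      using \<xi> \<rho>(1)[of m] by (simp add: abs_mult mult_ac)
    also have "\<dots> \<le> \<bar>H' (?D \<xi> p)\<bar>" using \<xi>(1) mult_right_mono[of 1 \<xi> "\<bar>H' (?D \<xi> p)\<bar>"] by (simp add: field_simps)
    finally show ?thesis using C order_trans by blast
  qed
  have "(\<lambda>m. LINT p|?M. s m p) \<longlonglongrightarrow> (LINT p|?M. H' p / N (E p) ^ k)"
  proof (rule integral_dominated_convergence[OF _ _ integrable_const_indicator[OF L, of "C * B"]])
    show "(\<lambda>p. H' p / N (E p) ^ k) \<in> borel_measurable ?M" by measurable
    show "s m \<in> borel_measurable ?M" for m
      unfolding s_def using HD_meas[of m] by measurable
    show "AE p in ?M. (\<lambda>m. s m p) \<longlonglongrightarrow> H' p / N (E p) ^ k"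
    proof (rule AE_I2)
      fix p
      have "(\<lambda>m. (H (?D (\<rho> m) p) - H p) * real (Suc m)) \<longlonglongrightarrow> H' p"
        using difference_quotient_sequence[OF deriv[of 1 p]]
        by (simp add: \<rho>_def lie_dilation_one[OF diagonalisable_A])
      from tendsto_mult_right[OF this, of "1 / N (E p) ^ k"]
      show "(\<lambda>m. s m p) \<longlonglongrightarrow> H' p / N (E p) ^ k" by (simp add: s_def)
    qed
    show "AE p in ?M. norm (s m p) \<le> C * B * indicator L p" for m
    proof (rule AE_I2)
      fix p
      show "norm (s m p) \<le> C * B * indicator L p"
      proof (cases "p \<in> L")
        case True
        have "(\<bar>H (?D (\<rho> m) p) - H p\<bar> * real (Suc m)) * (1 / N (E p) ^ k) \<le> C * B"
          using True B bound C0(2) N_nonneg[of "E p"] by (intro mult_mono) auto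
        then show ?thesis using True N_nonneg[of "E p"] by (simp add: s_def abs_mult)
      next
        case False
        then have "H p = 0" "H (?D (\<rho> m) p) = 0"
          using notL[of p 1] notL[of p "\<rho> m"] \<rho>[of m] H(2) by (auto simp: lie_dilation_one[OF diagonalisable_A])
        then show ?thesis by (simp add: s_def False)
      qed
    qed
  qed
  moreover have "(LINT p|?M. s m p) = (\<rho> m powr (real k - ?Q) - 1 powr (real k - ?Q)) * real (Suc m) * I" for m
  proof -
    have r: "\<rho> m > 0" using \<rho>(1)[of m] by simp
    \<comment> \<open>Homogeneity replaces \<open>N\<close> at \<open>p\<close> by \<open>N\<close>
      at the dilated point at the cost of the power \<open>k\<close>, so the whole quotient is a
      function of the dilated point and the measure supplies the power \<open>- Q\<close>.\<close>
    have eq: "H (?D (\<rho> m) p) / N (E p) ^ k = \<rho> m ^ k * (H (?D (\<rho> m) p) / N (E (?D (\<rho> m) p)) ^ k)" for p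
      using r by (simp add: N_dilation power_mult_distrib)
    have "integrable ?M (\<lambda>p. H (?D (\<rho> m) p) / N (E p) ^ k)"
    proof (rule integrable_quotient[OF L L0])
      show "continuous_on UNIV (\<lambda>p. H (?D (\<rho> m) p))"
        using linear_lie_dilation[OF diagonalisable_A r]
        by (intro continuous_on_compose2[OF H(1)] linear_continuous_on linear_conv_bounded_linear[THEN iffD1]) auto
      show "H (?D (\<rho> m) p) = 0" if "p \<notin> L" for p
        using notL[OF that, of "\<rho> m"] \<rho>[of m] H(2) by simp
    qed
    then have "(LINT p|?M. s m p)
        = ((LINT p|?M. H (?D (\<rho> m) p) / N (E p) ^ k) - I) * real (Suc m)"
      using int(1) unfolding s_def I_def by (simp add: diff_divide_distrib left_diff_distrib times_divide_eq_left[symmetric] del: times_divide_eq_left of_nat_Suc)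
    also have "(LINT p|?M. H (?D (\<rho> m) p) / N (E p) ^ k) = \<rho> m ^ k * (\<rho> m powr - ?Q * I)"
      unfolding eq integral_mult_right_zero I_def
      by (subst integral_coord_measure_dilation[OF haar r, of "\<lambda>p. H p / N (E p) ^ k"]) simp_all
    also have "\<dots> = \<rho> m powr (real k - ?Q) * I"
      using r by (simp add: powr_diff powr_minus powr_realpow divide_inverse)
    finally show ?thesis by (simp add: left_diff_distrib)
  qed
  moreover have "(\<lambda>m. (\<rho> m powr (real k - ?Q) - 1 powr (real k - ?Q)) * real (Suc m) * I) \<longlonglongrightarrow> (real k - ?Q) * I"
  proof -
    have "((\<lambda>r::real. r powr (real k - ?Q)) has_real_derivative (real k - ?Q)) (at 1)"
      by (auto intro!: derivative_eq_intros)
    from difference_quotient_sequence[OF this] show ?thesis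
      unfolding \<rho>_def by (rule tendsto_mult_right)
  qed
  ultimately have "(LINT p|?M. H' p / N (E p) ^ k) = (real k - ?Q) * I"
    using LIMSEQ_unique by simp
  moreover have "(LINT p|?M. (H' p + (?Q - real k) * H p) / N (E p) ^ k)
      = (LINT p|?M. H' p / N (E p) ^ k + (?Q - real k) * (H p / N (E p) ^ k))"
    by (simp add: add_divide_distrib)
  moreover have "\<dots> = (LINT p|?M. H' p / N (E p) ^ k) + (?Q - real k) * I"
    using Bochner_Integration.integral_add[OF int(2) integrable_mult_right[OF int(1), of "?Q - real k"]]
    by (simp only: integral_mult_right_zero I_def)
  ultimately show ?thesis by (simp add: left_diff_distrib)
qed

end

end

end


section \<open>The identity\<close>

text \<open>The pointwise numerator of the theorem: the factor in brackets on the right is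
  \<open>H' + (Q - 4) H\<close>. The square of \<open>w + (Q - 2) v\<close> cancels, which leaves
  only terms with the factor \<open>Q (Q - 4) / 2\<close>.\<close>

lemma radial_square_identity:
  fixes u v w :: "'a::real_inner" and Q :: real
  shows "(norm (w + (Q - 2) *\<^sub>R v + (Q * (Q - 4) / 4) *\<^sub>R u))\<^sup>2
       + Q * (Q - 4) / 2 * (norm (v + ((Q - 4) / 2) *\<^sub>R u))\<^sup>2
       - (norm (w + (Q - 2) *\<^sub>R v))\<^sup>2 + (Q * (Q - 4) / 4)\<^sup>2 * (norm u)\<^sup>2
     = Q * (Q - 4) / 2 * ((w \<bullet> u + v \<bullet> v + (Q - 2) * (v \<bullet> u))
         + (Q - 4) * (v \<bullet> u + (Q - 2) / 2 * (u \<bullet> u)))"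
proof -
  define a where "a = Q * (Q - 4) / 4"
  have e1: "(norm (w + (Q - 2) *\<^sub>R v + a *\<^sub>R u))\<^sup>2 - (norm (w + (Q - 2) *\<^sub>R v))\<^sup>2
      = 2 * a * (w \<bullet> u + (Q - 2) * (v \<bullet> u)) + a\<^sup>2 * (u \<bullet> u)"
    unfolding power2_norm_eq_inner
    by (simp add: inner_add_left inner_add_right inner_commute power2_eq_square distrib_left)
  have e2: "(norm (v + ((Q - 4) / 2) *\<^sub>R u))\<^sup>2 = v \<bullet> v + (Q - 4) * (v \<bullet> u) + ((Q - 4) / 2)\<^sup>2 * (u \<bullet> u)"
    unfolding power2_norm_eq_inner
    by (simp add: inner_add_left inner_add_right inner_commute power2_eq_square field_simps)
  have e3: "(norm u)\<^sup>2 = u \<bullet> u" by (simp add: power2_norm_eq_inner)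
  have e4: "Q * (Q - 4) / 2 = 2 * a" by (simp add: a_def)
  have e5: "2 * a * (w \<bullet> u + (Q - 2) * (v \<bullet> u)) + a\<^sup>2 * (u \<bullet> u)
      + 2 * a * (v \<bullet> v + (Q - 4) * (v \<bullet> u) + ((Q - 4) / 2)\<^sup>2 * (u \<bullet> u)) + a\<^sup>2 * (u \<bullet> u)
      = 2 * a * ((w \<bullet> u + v \<bullet> v + (Q - 2) * (v \<bullet> u)) + (Q - 4) * (v \<bullet> u + (Q - 2) / 2 * (u \<bullet> u)))"
  proof -
    \<comment> \<open>With the two copies of the square of \<open>a\<close>, this gives
      \<open>u \<bullet> u\<close> the coefficient \<open>2 a (Q - 4) (Q - 2) / 2\<close>.\<close>
    have "((Q - 4) / 2)\<^sup>2 = (Q - 4) * (Q - 2) / 2 - a"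
      by (simp add: a_def power2_eq_square field_simps)
    then show ?thesis unfolding power2_eq_square[of a] by (simp only:) (simp add: field_simps)
  qed
  have "x1 + 2 * a * x2 - x3 + y = (x1 - x3) + 2 * a * x2 + y" for x1 x2 x3 y :: real by simp
  then show ?thesis
    unfolding a_def[symmetric] e4 by (simp only: e1 e2 e3 e5)
qed

text \<open>With \<open>k\<close> standing for \<open>1 / N x\<close>, these extract the common
  factor \<open>1 / N^2\<close>. The \<open>- v\<close> from the second radial derivative turns
  \<open>q - 1\<close> into \<open>q - 2\<close>.\<close>

lemma scaleR_square_combine:
  fixes u v w :: complex and k q a :: real
  shows "k\<^sup>2 *\<^sub>R (w - v) + of_real (k * (q - 1)) * (k *\<^sub>R v) = k\<^sup>2 *\<^sub>R (w + (q - 2) *\<^sub>R v)"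
    and "of_real k * (k *\<^sub>R v) + of_real (k\<^sup>2 * a) * u = k\<^sup>2 *\<^sub>R (v + a *\<^sub>R u)"
    and "k\<^sup>2 *\<^sub>R w + of_real (k\<^sup>2 * a) * u = k\<^sup>2 *\<^sub>R (w + a *\<^sub>R u)"
  by (simp_all add: scaleR_conv_of_real power2_eq_square algebra_simps)

lemma L2_norm_square: "(L2_norm \<mu> g)\<^sup>2 = (LINT x|\<mu>. (cmod (g x))\<^sup>2)"
  by (simp add: L2_norm_def)

lemma integral_linear_combination:
  fixes f1 f2 f3 f4 :: "'a \<Rightarrow> real"
  assumes "integrable M f1" "integrable M f2" "integrable M f3" "integrable M f4"
  shows "(LINT x|M. f1 x + c * f2 x - f3 x + d * f4 x)
       = (LINT x|M. f1 x) + c * (LINT x|M. f2 x) - (LINT x|M. f3 x) + d * (LINT x|M. f4 x)"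
  using assms by simp

theorem theorem5p1:
  fixes \<A> :: "('g::{group_add, t2_space, second_countable_topology}, real ^ 'n::finite) chart set"
    and \<Theta> :: "real ^ 'n \<Rightarrow> ('g \<Rightarrow> real) \<Rightarrow> 'g \<Rightarrow> real"
    and E :: "real ^ 'n \<Rightarrow> 'g"
    and A :: "real ^ 'n \<Rightarrow> real ^ 'n"
    and Q :: real
    and N :: "'g \<Rightarrow> real"
    and R :: "('g \<Rightarrow> complex) \<Rightarrow> 'g \<Rightarrow> complex"
    and \<mu> :: "'g measure"
    and f :: "'g \<Rightarrow> complex"
  assumes "homogeneous_group \<A> \<Theta> E A"
    and "Q = homogeneous_dimension A" and "Q \<ge> 5"
    and "homogeneous_quasi_norm (group_dilation E A) N"
    and "R = radial_derivative (group_dilation E A) N"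
    and "haar_measure \<mu>"
    and "f \<in> test_functions_off_zero \<A>"
  shows "(L2_norm \<mu> (\<lambda>x. R (R f) x + of_real ((Q - 1) / N x) * R f x
              + of_real (Q * (Q - 4) / (4 * (N x)\<^sup>2)) * f x))\<^sup>2
         + Q * (Q - 4) / 2 *
           (L2_norm \<mu> (\<lambda>x. of_real (1 / N x) * R f x
              + of_real ((Q - 4) / (2 * (N x)\<^sup>2)) * f x))\<^sup>2
       = (L2_norm \<mu> (\<lambda>x. R (R f) x + of_real ((Q - 1) / N x) * R f x))\<^sup>2
         - (Q * (Q - 4) / 4)\<^sup>2 * (L2_norm \<mu> (\<lambda>x. f x / of_real ((N x)\<^sup>2)))\<^sup>2"
proof -
  interpret homogeneous_lie_group \<A> \<Theta> E A by standard fact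
  note N = assms(4) and haar = assms(6)
  let ?M = "coord_measure \<mu>"
  define u v w where "u = (\<lambda>p. f (E p))" and "v = euler A u" and "w = euler A v"
  have smooth: "smooth_on UNIV u" "smooth_on UNIV v" "smooth_on UNIV w"
    using assms(7) by (auto simp: test_functions_off_zero_def smooth_fun_iff u_def v_def w_def
        intro!: smooth_on_euler linear_A)
  note cont = smooth[THEN smooth_on_continuous]
  define K where "K = lg ` closure {x. f x \<noteq> 0}"
  have K: "compact K" "0 \<notin> K"
  proof -
    show "compact K"
      using assms(7) unfolding K_def
      by (intro compact_continuous_image continuous_on_lg) (simp add: test_functions_off_zero_def)
    have "0 \<notin> closure {x. f x \<noteq> 0}" using assms(7) by (auto simp: test_functions_off_zero_def)
    moreover have "x = 0" if "lg x = 0" for x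
      using E_lg[of x] that by simp
    ultimately show "0 \<notin> K" unfolding K_def by force
  qed
  have supp_u: "u p = 0" if "p \<notin> K" for p
  proof (rule ccontr)
    assume "u p \<noteq> 0"
    then have "E p \<in> closure {x. f x \<noteq> 0}" by (auto simp: u_def intro!: closure_subset[THEN subsetD])
    then have "lg (E p) \<in> K" unfolding K_def by (rule imageI)
    then show False using that by simp
  qed
  have supp_v: "v p = 0" if "p \<notin> K" for p
    unfolding v_def by (rule euler_eq_0[OF compact_imp_closed[OF K(1)] supp_u that])
  have supp_w: "w p = 0" if "p \<notin> K" for p
    unfolding w_def by (rule euler_eq_0[OF compact_imp_closed[OF K(1)] supp_v that])
  have Rf: "R f x = (1 / N x) *\<^sub>R v (lg x)" for x
    unfolding assms(5) using radial_derivative_eq[OF N smooth(1), of f 0 x] by (simp add: u_def v_def)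
  \<comment> \<open>The formula is applied again to \<open>R f\<close>, which is
    \<open>v / N\<close>; the exponent \<open>1\<close> of \<open>1 / N\<close> produces the term
    \<open>- v\<close>.\<close>
  have RRf: "R (R f) x = (1 / N x)\<^sup>2 *\<^sub>R (w (lg x) - v (lg x))" for x
    using radial_derivative_eq[OF N smooth(2), of "R f" 1 x] Rf
    by (simp add: w_def power2_eq_square flip: assms(5))
  \<comment> \<open>The numerators of the four integrands over the common denominator
    \<open>N ^ 4\<close>.\<close>
  define P1 P2 P3 P4 where "P1 = (\<lambda>p. (cmod (w p + (Q - 2) *\<^sub>R v p + (Q * (Q - 4) / 4) *\<^sub>R u p))\<^sup>2)"
    and "P2 = (\<lambda>p. (cmod (v p + ((Q - 4) / 2) *\<^sub>R u p))\<^sup>2)"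
    and "P3 = (\<lambda>p. (cmod (w p + (Q - 2) *\<^sub>R v p))\<^sup>2)"
    and "P4 = (\<lambda>p. (cmod (u p))\<^sup>2)"
  note P_defs = P1_def P2_def P3_def P4_def
  have contP: "continuous_on UNIV P1" "continuous_on UNIV P2" "continuous_on UNIV P3" "continuous_on UNIV P4"
    unfolding P_defs by (intro continuous_intros cont)+
  have int: "integrable ?M (\<lambda>p. P1 p / N (E p) ^ 4)" "integrable ?M (\<lambda>p. P2 p / N (E p) ^ 4)"
    "integrable ?M (\<lambda>p. P3 p / N (E p) ^ 4)" "integrable ?M (\<lambda>p. P4 p / N (E p) ^ 4)"
    using contP by (intro integrable_quotient[OF N haar K]; simp add: P_defs supp_u supp_v supp_w)+
  have scaled: "(L2_norm \<mu> g)\<^sup>2 = (LINT p|?M. (cmod (G p))\<^sup>2 / N (E p) ^ 4)"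
    if "continuous_on UNIV G" "\<And>x. g x = (1 / N x)\<^sup>2 *\<^sub>R G (lg x)" for g G
  proof -
    have sq: "(cmod (g (E p)))\<^sup>2 = (cmod (G p))\<^sup>2 / N (E p) ^ 4" for p
      by (simp add: that(2) power_divide power_mult_distrib flip: power_mult)
    have [measurable]: "G \<in> borel_measurable borel" "(\<lambda>p. N (E p)) \<in> borel_measurable borel"
      using borel_measurable_continuous_onI[OF that(1)] N_measurable[OF N] by auto
    have "(\<lambda>p. (cmod (g (E p)))\<^sup>2) \<in> borel_measurable borel"
      unfolding sq by measurable
    from integral_haar[OF haar this] show ?thesis by (simp add: L2_norm_square sq)
  qed
  have quotients: "(Q - 1) / N x = 1 / N x * (Q - 1)"
    "Q * (Q - 4) / (4 * (N x)\<^sup>2) = (1 / N x)\<^sup>2 * (Q * (Q - 4) / 4)"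
    "(Q - 4) / (2 * (N x)\<^sup>2) = (1 / N x)\<^sup>2 * ((Q - 4) / 2)"
    "f x / of_real ((N x)\<^sup>2) = (1 / N x)\<^sup>2 *\<^sub>R f x" for x
    by (simp_all add: power_divide scaleR_conv_of_real)
  have u_lg: "u (lg x) = f x" for x by (simp add: u_def)
  have T1: "(L2_norm \<mu> (\<lambda>x. R (R f) x + of_real ((Q - 1) / N x) * R f x
              + of_real (Q * (Q - 4) / (4 * (N x)\<^sup>2)) * f x))\<^sup>2 = (LINT p|?M. P1 p / N (E p) ^ 4)"
    unfolding P1_def RRf Rf quotients scaleR_square_combine
    by (rule scaled) (intro continuous_intros cont, simp only: u_lg)
  have T2: "(L2_norm \<mu> (\<lambda>x. of_real (1 / N x) * R f x
              + of_real ((Q - 4) / (2 * (N x)\<^sup>2)) * f x))\<^sup>2 = (LINT p|?M. P2 p / N (E p) ^ 4)"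
    unfolding P2_def Rf quotients scaleR_square_combine
    by (rule scaled) (intro continuous_intros cont, simp only: u_lg)
  have T3: "(L2_norm \<mu> (\<lambda>x. R (R f) x + of_real ((Q - 1) / N x) * R f x))\<^sup>2
      = (LINT p|?M. P3 p / N (E p) ^ 4)"
    unfolding P3_def RRf Rf quotients scaleR_square_combine
    by (rule scaled) (intro continuous_intros cont, simp only: u_lg)
  have T4: "(L2_norm \<mu> (\<lambda>x. f x / of_real ((N x)\<^sup>2)))\<^sup>2 = (LINT p|?M. P4 p / N (E p) ^ 4)"
    unfolding P4_def quotients
    by (rule scaled) (intro continuous_intros cont, simp only: u_lg)
  \<comment> \<open>On complex numbers \<open>\<bullet>\<close> is the real inner product, so
    \<open>v p \<bullet> u p\<close> is the real part of \<open>v cnj u\<close>.\<close>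
  define H where "H p = v p \<bullet> u p + (Q - 2) / 2 * (u p \<bullet> u p)" for p
  define H' where "H' p = w p \<bullet> u p + v p \<bullet> v p + (Q - 2) * (v p \<bullet> u p)" for p
  have "(LINT p|?M. (H' p + (homogeneous_dimension A - real 4) * H p) / N (E p) ^ 4) = 0"
  proof (rule integral_radial_divergence[OF N haar K])
    show "continuous_on UNIV H" "continuous_on UNIV H'"
      unfolding H_def H'_def by (intro continuous_intros cont)+
    show "p \<notin> K \<Longrightarrow> H p = 0" "p \<notin> K \<Longrightarrow> H' p = 0" for p
      by (simp_all add: H_def H'_def supp_u supp_v)
    fix r :: real and p assume r: "r > 0"
    let ?D = "\<lambda>r. lie_dilation A r p"
    have u': "((\<lambda>r. u (?D r)) has_vector_derivative (1 / r) *\<^sub>R v (?D r)) (at r)"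
      and v': "((\<lambda>r. v (?D r)) has_vector_derivative (1 / r) *\<^sub>R w (?D r)) (at r)"
      unfolding v_def w_def
      using dilation_has_vector_derivative[OF smooth(1) r] dilation_has_vector_derivative[OF smooth(2) r]
      by (simp_all add: v_def)
    note inner' = bounded_bilinear.has_vector_derivative[OF bounded_bilinear_inner,
        folded has_real_derivative_iff_has_vector_derivative]
    have "((\<lambda>r. H (?D r)) has_real_derivative
        v (?D r) \<bullet> (1 / r) *\<^sub>R v (?D r) + (1 / r) *\<^sub>R w (?D r) \<bullet> u (?D r)
        + (Q - 2) / 2 * (u (?D r) \<bullet> (1 / r) *\<^sub>R v (?D r) + (1 / r) *\<^sub>R v (?D r) \<bullet> u (?D r))) (at r)"
      unfolding H_def by (intro DERIV_add DERIV_cmult inner'[OF v' u'] inner'[OF u' u'])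
    also have "v (?D r) \<bullet> (1 / r) *\<^sub>R v (?D r) + (1 / r) *\<^sub>R w (?D r) \<bullet> u (?D r)
        + (Q - 2) / 2 * (u (?D r) \<bullet> (1 / r) *\<^sub>R v (?D r) + (1 / r) *\<^sub>R v (?D r) \<bullet> u (?D r)) = H' (?D r) / r"
      using r by (simp add: H'_def inner_commute field_simps)
    finally show "((\<lambda>r. H (?D r)) has_real_derivative H' (?D r) / r) (at r)" .
  qed
  \<comment> \<open>The identity holds pointwise only up to the divergence term, whose integral has
    just been shown to vanish.\<close>
  moreover have "P1 p / N (E p) ^ 4 + Q * (Q - 4) / 2 * (P2 p / N (E p) ^ 4) - P3 p / N (E p) ^ 4
      + (Q * (Q - 4) / 4)\<^sup>2 * (P4 p / N (E p) ^ 4)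
      = Q * (Q - 4) / 2 * ((H' p + (homogeneous_dimension A - real 4) * H p) / N (E p) ^ 4)" for p
  proof -
    have "x1 / n + c * (x2 / n) - x3 / n + d * (x4 / n) = (x1 + c * x2 - x3 + d * x4) / n" for x1 x2 x3 x4 c d n :: real
      by (simp add: add_divide_distrib diff_divide_distrib)
    moreover have "P1 p + Q * (Q - 4) / 2 * P2 p - P3 p + (Q * (Q - 4) / 4)\<^sup>2 * P4 p
        = Q * (Q - 4) / 2 * (H' p + (homogeneous_dimension A - real 4) * H p)"
      unfolding P_defs H_def H'_def radial_square_identity assms(2)[symmetric] by simp
    ultimately show ?thesis by (simp only: times_divide_eq_right)
  qed
  then have "(LINT p|?M. P1 p / N (E p) ^ 4 + Q * (Q - 4) / 2 * (P2 p / N (E p) ^ 4) - P3 p / N (E p) ^ 4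
      + (Q * (Q - 4) / 4)\<^sup>2 * (P4 p / N (E p) ^ 4))
      = Q * (Q - 4) / 2 * (LINT p|?M. (H' p + (homogeneous_dimension A - real 4) * H p) / N (E p) ^ 4)"
    by (simp only: integral_mult_right_zero)
  ultimately have "(LINT p|?M. P1 p / N (E p) ^ 4 + Q * (Q - 4) / 2 * (P2 p / N (E p) ^ 4) - P3 p / N (E p) ^ 4
      + (Q * (Q - 4) / 4)\<^sup>2 * (P4 p / N (E p) ^ 4)) = 0" by simp
  moreover have "(LINT p|?M. P1 p / N (E p) ^ 4 + Q * (Q - 4) / 2 * (P2 p / N (E p) ^ 4) - P3 p / N (E p) ^ 4
      + (Q * (Q - 4) / 4)\<^sup>2 * (P4 p / N (E p) ^ 4))
      = (LINT p|?M. P1 p / N (E p) ^ 4) + Q * (Q - 4) / 2 * (LINT p|?M. P2 p / N (E p) ^ 4)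
      - (LINT p|?M. P3 p / N (E p) ^ 4) + (Q * (Q - 4) / 4)\<^sup>2 * (LINT p|?M. P4 p / N (E p) ^ 4)"
    by (rule integral_linear_combination) (fact int)+
  ultimately show ?thesis unfolding T1 T2 T3 T4 by linarith
qed

end
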